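(* Let $\mu_r:(\mathbf{Sym}^{(\ell)})^{\otimes r}\to\mathbf{Sym}^{(\ell)}$ be the product map, let $\Delta^{(r)}:\mathbf{Sym}^{(\ell)}\to(\mathbf{Sym}^{(\ell)})^{\otimes r}$ be the $r$-fold coproduct, and let $*_r$ be the (componentwise) extension of the internal product $*$ to $(\mathbf{Sym}^{(\ell)})^{\otimes r}$. Then, for all $F_1,\ldots,F_r$ and $G$ in $\mathbf{Sym}^{(\ell)}$, $$(F_1\cdots F_r)*G=\mu_r\left[(F_1\otimes\cdots\otimes F_r)*_r\Delta^{(r)}G\right].$$
   Context: The color set $C$ (with $\ell$ elements, $\ell=\infty$ allowed) is an additive semigroup such that every $\gamma\in C$ has only finitely many decompositions $\gamma=\alpha+\beta$ with $\alpha,\beta\in C$. Let $\mathbb{N}^{\ell}$ denote the set of finitely supported vectors $\mathbf{n}=(n_c)_{c\in C}$ of nonnegative integers. $\mathbf{Sym}^{(\ell)}$ is the free associative algebra on symbols $S_{\mathbf{n}}$, $\mathbf{n}\in\mathbb{N}^\ell\setminus\{0\}$ (with $S_{\mathbf{0}}=1$), with the Hopf algebra structure $\Delta S_{\mathbf{n}}=\sum_{\mathbf{i}+\mathbf{j}=\mathbf{n}}S_{\mathbf{i}}\otimes S_{\mathbf{j}}$. It has the linear basis $S^{\mathbf{I}}=S_{\mathbf{i}_1}\cdots S_{\mathbf{i}_m}$, where $\mathbf{I}=(\mathbf{i}_1,\ldots,\mathbf{i}_m)$ runs over vector compositions, i.e. finite sequences of nonzero vectors (columns) of $\mathbb{N}^\ell$.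 $QSym^{(\ell)}$ is the algebra with basis $$M_{\mathbf{I}}(\mathbb{X})=\sum_{j_1<\cdots<j_m}\mathbf{x}_{j_1}^{\mathbf{i}_1}\cdots\mathbf{x}_{j_m}^{\mathbf{i}_m},\qquad \mathbf{x}_j^{\mathbf{i}}=\prod_{c\in C}(x_j^{(c)})^{i_c},$$ where $\mathbb{X}=\{x_j^{(c)}: c\in C\}$ is a set of commuting variables with $j$ running over a totally ordered set. It is paired with $\mathbf{Sym}^{(\ell)}$ by $\langle M_{\mathbf{I}},S^{\mathbf{J}}\rangle=\delta_{\mathbf{I},\mathbf{J}}$. For two such alphabets $\mathbb{X}=\{x_r^{(c)}\}$, $\mathbb{Y}=\{y_s^{(c)}\}$, let $\mathbb{X}\times_C\mathbb{Y}$ be the $C$-colored alphabet with variables $t_{rs}^{(\gamma)}=\sum_{\alpha+\beta=\gamma}x_r^{(\alpha)}y_s^{(\beta)}$, with pairs $(r,s)$ ordered lexicographically, and let $\delta:QSym^{(\ell)}\to QSym^{(\ell)}\otimes QSym^{(\ell)}$, $\delta(F)=F(\mathbb{X}\times_C\mathbb{Y})$, where $f(\mathbb{X})g(\mathbb{Y})$ is identified with $f\otimes g$. The internal product $*$ on $\mathbf{Sym}^{(\ell)}$ is the product dual to $\delta$: the coefficient of $S^{\mathbf{K}}$ in $S^{\mathbf{I}}*S^{\mathbf{J}}$ is the coefficient of $M_{\mathbf{I}}\otimes M_{\mathbf{J}}$ in $\delta(M_{\mathbf{K}})$. *)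

theory Defs
  imports
    Complex_Main
    "HOL-Library.Poly_Mapping"
    "HOL-Library.Product_Plus"
    "HOL-Library.Product_Lexorder"
begin

section \<open>Linear and bilinear extension from a basis\<close>

text \<open>
  A free \<open>'k\<close>-module with basis \<open>'a\<close> is rendered as \<open>'a \<Rightarrow>\<^sub>0 'k\<close>; the tensor product of the
  free modules on \<open>'a\<close> and \<open>'b\<close> is the free module on \<open>'a \<times> 'b\<close>.
\<close>

definition fscale :: "'k::comm_ring_1 \<Rightarrow> ('a \<Rightarrow>\<^sub>0 'k) \<Rightarrow> ('a \<Rightarrow>\<^sub>0 'k)" where
  "fscale c F = Poly_Mapping.map ((*) c) F"

definition lin_ext :: "('a \<Rightarrow> ('b \<Rightarrow>\<^sub>0 'k)) \<Rightarrow> ('a \<Rightarrow>\<^sub>0 'k) \<Rightarrow> ('b \<Rightarrow>\<^sub>0 'k::comm_ring_1)" where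
  "lin_ext f F = (\<Sum>a\<in>Poly_Mapping.keys F. fscale (Poly_Mapping.lookup F a) (f a))"

definition bilin_ext ::
  "('a \<Rightarrow> 'b \<Rightarrow> ('d \<Rightarrow>\<^sub>0 'k)) \<Rightarrow> ('a \<Rightarrow>\<^sub>0 'k) \<Rightarrow> ('b \<Rightarrow>\<^sub>0 'k) \<Rightarrow> ('d \<Rightarrow>\<^sub>0 'k::comm_ring_1)" where
  "bilin_ext f F G = lin_ext (\<lambda>a. lin_ext (f a) G) F"


section \<open>Vector compositions and the Hopf algebra of colored noncommutative symmetric functions\<close>

typedef 'c vcomp = "{I :: ('c \<Rightarrow>\<^sub>0 nat) list. 0 \<notin> set I}"
  morphisms columns Vcomp
  by (rule exI[of _ "[]"]) simp

text \<open>Vector compositions form the free monoid (written additively) on the nonzero vectors.\<close>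

instantiation vcomp :: (type) monoid_add
begin

definition zero_vcomp :: "'a vcomp" where
  "0 = Vcomp []"

definition plus_vcomp :: "'a vcomp \<Rightarrow> 'a vcomp \<Rightarrow> 'a vcomp" where
  "I + J = Vcomp (columns I @ columns J)"

instance
proof
  fix I J K :: "'a vcomp"
  have *: "columns (I + J) = columns I @ columns J" for I J :: "'a vcomp"
    using columns[of I] columns[of J] by (simp add: plus_vcomp_def Vcomp_inverse)
  have **: "columns (0 :: 'a vcomp) = []"
    by (simp add: zero_vcomp_def Vcomp_inverse)
  show "I + J + K = I + (J + K)" "0 + I = I" "I + 0 = I"
    by (simp_all add: columns_inject[symmetric] * **)
qed

end

text \<open>
  The type \<open>('c, 'k) sym\<close> is the monoid algebra of that free monoid, i.e. the free associative
  algebra on the symbols \<open>S\<^sub>n\<close>, \<open>n \<noteq> 0\<close>. Its ring structure is the one of \<^theory>\<open>HOL-Library.Poly_Mapping\<close>.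
  Likewise \<open>'c vcomp \<times> 'c vcomp \<Rightarrow>\<^sub>0 'k\<close> carries the ring structure of the tensor square, namely
  \<open>(F \<otimes> G) (F' \<otimes> G') = F F' \<otimes> G G'\<close>.
\<close>

type_synonym ('c, 'k) sym = "'c vcomp \<Rightarrow>\<^sub>0 'k"
type_synonym ('c, 'k) sym2 = "'c vcomp \<times> 'c vcomp \<Rightarrow>\<^sub>0 'k"

definition Sbasis :: "'c vcomp \<Rightarrow> ('c, 'k::comm_ring_1) sym" where
  "Sbasis I = Poly_Mapping.single I 1"

text \<open>\<open>one_column n\<close> is the empty composition for \<open>n = 0\<close>, in accordance with \<open>S\<^sub>0 = 1\<close>.\<close>

definition one_column :: "('c \<Rightarrow>\<^sub>0 nat) \<Rightarrow> 'c vcomp" where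
  "one_column n = Vcomp (if n = 0 then [] else [n])"

definition coproduct_gen :: "('c \<Rightarrow>\<^sub>0 nat) \<Rightarrow> ('c, 'k::comm_ring_1) sym2" where
  "coproduct_gen n =
    (\<Sum>(i, j)\<in>{(i, j). i + j = n}. Poly_Mapping.single (one_column i, one_column j) 1)"

text \<open>The coproduct is the algebra morphism with the above values on the generators \<open>S\<^sub>n\<close>.\<close>

definition coproduct :: "('c, 'k::comm_ring_1) sym \<Rightarrow> ('c, 'k) sym2" where
  "coproduct = lin_ext (\<lambda>I. prod_list (map coproduct_gen (columns I)))"


section \<open>Tensor powers\<close>

text \<open>
  The \<open>r\<close>-th tensor power is spanned by the lists of \<open>r\<close> vector compositions: the list
  \<open>[I\<^sub>1, \<dots>, I\<^sub>r]\<close> stands for the tensor product of the basis elements indexed by \<open>I\<^sub>1, \<dots>, I\<^sub>r\<close>.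
  The type below comprises all tensor powers at once.
\<close>

type_synonym ('c, 'k) sym_tensors = "'c vcomp list \<Rightarrow>\<^sub>0 'k"

definition tensor_cons ::
  "('c, 'k::comm_ring_1) sym \<Rightarrow> ('c, 'k) sym_tensors \<Rightarrow> ('c, 'k) sym_tensors" where
  "tensor_cons = bilin_ext (\<lambda>I Is. Poly_Mapping.single (I # Is) 1)"

text \<open>\<open>pure_tensor [F\<^sub>1, \<dots>, F\<^sub>r]\<close> is \<open>F\<^sub>1 \<otimes> \<dots> \<otimes> F\<^sub>r\<close>.\<close>

definition pure_tensor :: "('c, 'k::comm_ring_1) sym list \<Rightarrow> ('c, 'k) sym_tensors" where
  "pure_tensor Fs = foldr tensor_cons Fs (Poly_Mapping.single [] 1)"

definition tensor_mult :: "('c, 'k::comm_ring_1) sym_tensors \<Rightarrow> ('c, 'k) sym" where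
  "tensor_mult = lin_ext (\<lambda>Is. prod_list (map Sbasis Is))"

text \<open>
  The \<open>r\<close>-fold coproduct takes values in the \<open>r\<close>-th tensor power: it is the identity for \<open>r = 1\<close>,
  the coproduct for \<open>r = 2\<close>, and \<open>\<Delta>\<^sup>(\<^sup>r\<^sup>+\<^sup>1\<^sup>) = (id \<otimes> \<Delta>\<^sup>(\<^sup>r\<^sup>)) \<circ> \<Delta>\<close>. For \<open>r = 0\<close> it is the counit
  (the coefficient of \<open>S\<^sub>0 = 1\<close>).
\<close>

fun iterated_coproduct ::
  "nat \<Rightarrow> ('c, 'k::comm_ring_1) sym \<Rightarrow> ('c, 'k) sym_tensors" where
  "iterated_coproduct 0 G = Poly_Mapping.single [] (Poly_Mapping.lookup G 0)"
| "iterated_coproduct (Suc 0) G = pure_tensor [G]"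
| "iterated_coproduct (Suc (Suc r)) G =
    lin_ext (\<lambda>(I, J). tensor_cons (Sbasis I) (iterated_coproduct (Suc r) (Sbasis J))) (coproduct G)"


section \<open>Formal power series in arbitrarily many commuting variables\<close>

text \<open>A power series is given by its coefficients on the monomials \<open>'v \<Rightarrow>\<^sub>0 nat\<close>.\<close>

typedef ('v, 'k) mps = "UNIV :: (('v \<Rightarrow>\<^sub>0 nat) \<Rightarrow> 'k) set"
  morphisms mcoeff Mps ..

lemma mps_eqI: "(\<And>m. mcoeff f m = mcoeff g m) \<Longrightarrow> f = g"
  by (simp add: mcoeff_inject[symmetric] fun_eq_iff)

lemma finite_decompositions:
  fixes m :: "'v \<Rightarrow>\<^sub>0 nat"
  shows "finite {(a, b). a + b = m}"
proof -
  let ?F = "{f. \<forall>v. (v \<in> Poly_Mapping.keys m \<longrightarrow> f v \<in> (\<Union>v\<in>Poly_Mapping.keys m. {..Poly_Mapping.lookup m v}))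
     \<and> (v \<notin> Poly_Mapping.keys m \<longrightarrow> f v = (0::nat))}"
  have "finite ?F"
    by (rule finite_set_of_finite_funs) auto
  moreover have "Poly_Mapping.lookup ` {a. \<exists>b. a + b = m} \<subseteq> ?F"
    by (fastforce simp: lookup_add in_keys_iff)
  ultimately have "finite (Poly_Mapping.lookup ` {a. \<exists>b. a + b = m})"
    by (rule rev_finite_subset)
  then have fin: "finite {a. \<exists>b. a + b = m}"
    by (rule finite_imageD) (auto simp: inj_on_def lookup_inject)
  have "{(a, b). a + b = m} \<subseteq> (\<lambda>a. (a, m - a)) ` {a. \<exists>b. a + b = m}"
    by auto
  with fin show ?thesis
    by (meson finite_imageI rev_finite_subset)
qed

instantiation mps :: (type, comm_ring_1) comm_ring_1
begin

definition zero_mps :: "('a, 'b) mps" where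
  "0 = Mps (\<lambda>_. 0)"
definition one_mps :: "('a, 'b) mps" where
  "1 = Mps (\<lambda>m. if m = 0 then 1 else 0)"
definition plus_mps :: "('a, 'b) mps \<Rightarrow> ('a, 'b) mps \<Rightarrow> ('a, 'b) mps" where
  "f + g = Mps (\<lambda>m. mcoeff f m + mcoeff g m)"
definition uminus_mps :: "('a, 'b) mps \<Rightarrow> ('a, 'b) mps" where
  "- f = Mps (\<lambda>m. - mcoeff f m)"
definition minus_mps :: "('a, 'b) mps \<Rightarrow> ('a, 'b) mps \<Rightarrow> ('a, 'b) mps" where
  "f - g = Mps (\<lambda>m. mcoeff f m - mcoeff g m)"
definition times_mps :: "('a, 'b) mps \<Rightarrow> ('a, 'b) mps \<Rightarrow> ('a, 'b) mps" where
  "f * g = Mps (\<lambda>m. \<Sum>(a, b)\<in>{(a, b). a + b = m}. mcoeff f a * mcoeff g b)"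

lemma mcoeff_simps:
  fixes f g :: "('a, 'b) mps"
  shows "mcoeff (0 :: ('a, 'b) mps) m = 0"
    and "mcoeff (1 :: ('a, 'b) mps) m = (if m = 0 then 1 else 0)"
    and "mcoeff (f + g) m = mcoeff f m + mcoeff g m"
    and "mcoeff (- f) m = - mcoeff f m"
    and "mcoeff (f - g) m = mcoeff f m - mcoeff g m"
    and "mcoeff (f * g) m = (\<Sum>(a, b)\<in>{(a, b). a + b = m}. mcoeff f a * mcoeff g b)"
  by (simp_all add: zero_mps_def one_mps_def plus_mps_def uminus_mps_def minus_mps_def
      times_mps_def Mps_inverse)

instance
proof
  fix f g h :: "('a, 'b) mps"
  show "f * g * h = f * (g * h)"
  proof (rule mps_eqI)
    fix m :: "'a \<Rightarrow>\<^sub>0 nat"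
    let ?D = "\<lambda>m :: 'a \<Rightarrow>\<^sub>0 nat. {(a, b). a + b = m}"
    let ?f = "mcoeff f" and ?g = "mcoeff g" and ?h = "mcoeff h"
    have "(\<Sum>p\<in>?D m. (\<Sum>q\<in>?D (fst p). ?f (fst q) * ?g (snd q)) * ?h (snd p)) =
          (\<Sum>(p, q)\<in>Sigma (?D m) (\<lambda>p. ?D (fst p)). ?f (fst q) * ?g (snd q) * ?h (snd p))"
      by (simp add: sum_distrib_right sum.Sigma finite_decompositions)
    also have "\<dots> = (\<Sum>(p, q)\<in>Sigma (?D m) (\<lambda>p. ?D (snd p)). ?f (fst p) * (?g (fst q) * ?h (snd q)))"
      by (rule sum.reindex_bij_witness[where
            i = "\<lambda>(p, q). ((fst p + fst q, snd q), (fst p, fst q))" and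
            j = "\<lambda>(p, q). ((fst q, snd q + snd p), (snd q, snd p))"])
         (auto simp: add.assoc mult.assoc)
    also have "\<dots> = (\<Sum>p\<in>?D m. ?f (fst p) * (\<Sum>q\<in>?D (snd p). ?g (fst q) * ?h (snd q)))"
      by (simp add: sum_distrib_left sum.Sigma finite_decompositions)
    finally show "mcoeff (f * g * h) m = mcoeff (f * (g * h)) m"
      by (simp add: mcoeff_simps split_def)
  qed
  show "f * g = g * f"
    by (rule mps_eqI, unfold mcoeff_simps,
        rule sum.reindex_bij_witness[where i = prod.swap and j = prod.swap])
       (auto simp: ac_simps)
  show "1 * f = f"
  proof (rule mps_eqI)
    fix m :: "'a \<Rightarrow>\<^sub>0 nat"
    have "(\<Sum>(a, b)\<in>{(a, b). a + b = m}. (if a = 0 then 1 else 0) * mcoeff f b) =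
          (\<Sum>(a, b)\<in>{(0 :: 'a \<Rightarrow>\<^sub>0 nat, m)}. (if a = 0 then 1 else 0) * mcoeff f b)"
      by (rule sum.mono_neutral_right) (auto simp: finite_decompositions split: if_splits)
    then show "mcoeff (1 * f) m = mcoeff f m"
      by (simp add: mcoeff_simps)
  qed
  show "(f + g) * h = f * h + g * h"
    by (rule mps_eqI) (simp add: mcoeff_simps split_def distrib_right sum.distrib)
  show "(0 :: ('a, 'b) mps) \<noteq> 1"
  proof
    assume "(0 :: ('a, 'b) mps) = 1"
    then have "mcoeff (0 :: ('a, 'b) mps) 0 = mcoeff (1 :: ('a, 'b) mps) 0" by simp
    then show False by (simp add: mcoeff_simps)
  qed
qed (rule mps_eqI; simp add: mcoeff_simps algebra_simps; fail)+

end

definition mvar :: "'v \<Rightarrow> ('v, 'k::comm_ring_1) mps" where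
  "mvar v = Mps (\<lambda>m. if m = Poly_Mapping.single v 1 then 1 else 0)"

definition mscale :: "'k::comm_ring_1 \<Rightarrow> ('v, 'k) mps \<Rightarrow> ('v, 'k) mps" where
  "mscale c f = Mps (\<lambda>m. c * mcoeff f m)"

interpretation mps: module mscale
  by standard (rule mps_eqI; simp add: mscale_def Mps_inverse mcoeff_simps algebra_simps)+


section \<open>Colored quasi-symmetric functions\<close>

text \<open>
  A colored alphabet indexed by a totally ordered set \<open>'j\<close> is a function \<open>A\<close>, where \<open>A j c\<close> is the
  variable (or power series) of color \<open>c\<close> at position \<open>j\<close>.
\<close>

definition alphabet_power ::
  "('j \<Rightarrow> 'c \<Rightarrow> ('v, 'k::comm_ring_1) mps) \<Rightarrow> 'j \<Rightarrow> ('c \<Rightarrow>\<^sub>0 nat) \<Rightarrow> ('v, 'k) mps" where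
  "alphabet_power A j i = (\<Prod>c\<in>Poly_Mapping.keys i. A j c ^ Poly_Mapping.lookup i c)"

text \<open>
  The infinite sum over \<open>j\<^sub>1 < \<dots> < j\<^sub>m\<close> is taken coefficientwise: for the alphabets below, each
  monomial occurs in only finitely many of the summands.
\<close>

definition qsym_M ::
  "'c vcomp \<Rightarrow> ('j::linorder \<Rightarrow> 'c \<Rightarrow> ('v, 'k::comm_ring_1) mps) \<Rightarrow> ('v, 'k) mps" where
  "qsym_M I A = Mps (\<lambda>m. Sum_any (\<lambda>js.
     if sorted_wrt (<) js \<and> length js = length (columns I)
     then mcoeff (prod_list (map2 (alphabet_power A) js (columns I))) m else 0))"

text \<open>
  The alphabets \<open>X\<close> and \<open>Y\<close> live in one ring of power series, with the variables \<open>Inl (j, c)\<close> for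
  \<open>X\<close> and \<open>Inr (j, c)\<close> for \<open>Y\<close>. The pairs \<open>(r, s)\<close> indexing \<open>alph_XY\<close> are ordered
  lexicographically by \<^theory>\<open>HOL-Library.Product_Lexorder\<close>.
\<close>

type_synonym 'c xyvar = "nat \<times> 'c + nat \<times> 'c"

definition alph_X :: "nat \<Rightarrow> 'c \<Rightarrow> ('c xyvar, 'k::comm_ring_1) mps" where
  "alph_X r c = mvar (Inl (r, c))"

definition alph_Y :: "nat \<Rightarrow> 'c \<Rightarrow> ('c xyvar, 'k::comm_ring_1) mps" where
  "alph_Y s c = mvar (Inr (s, c))"

definition alph_XY ::
  "nat \<times> nat \<Rightarrow> 'c::semigroup_add \<Rightarrow> ('c xyvar, 'k::comm_ring_1) mps" where
  "alph_XY = (\<lambda>(r, s) \<gamma>. \<Sum>(\<alpha>, \<beta>)\<in>{(\<alpha>, \<beta>). \<alpha> + \<beta> = \<gamma>}. alph_X r \<alpha> * alph_Y s \<beta>)"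

text \<open>\<open>M\<^sub>I \<otimes> M\<^sub>J\<close>, identified with \<open>M\<^sub>I(X) M\<^sub>J(Y)\<close>, and \<open>\<delta>(M\<^sub>K) = M\<^sub>K(X \<times>\<^sub>C Y)\<close>.\<close>

definition qsym_MM :: "'c vcomp \<Rightarrow> 'c vcomp \<Rightarrow> ('c xyvar, 'k::comm_ring_1) mps" where
  "qsym_MM I J = qsym_M I alph_X * qsym_M J alph_Y"

definition qsym_delta :: "'c::semigroup_add vcomp \<Rightarrow> ('c xyvar, 'k::comm_ring_1) mps" where
  "qsym_delta K = qsym_M K alph_XY"

definition delta_coeff ::
  "'c::semigroup_add vcomp \<Rightarrow> 'c vcomp \<Rightarrow> 'c vcomp \<Rightarrow> 'k::comm_ring_1" where
  "delta_coeff K I J =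
     mps.representation (range (\<lambda>(I, J). qsym_MM I J)) (qsym_delta K) (qsym_MM I J)"


section \<open>The internal product\<close>

text \<open>
  If every color has only finitely many decompositions, then for given \<open>I\<close> and \<open>J\<close> only finitely
  many \<open>K\<close> have a nonzero coefficient, so that \<^const>\<open>Abs_poly_mapping\<close> is applied to a function of
  finite support.
\<close>

definition internal_basis ::
  "'c::semigroup_add vcomp \<Rightarrow> 'c vcomp \<Rightarrow> ('c, 'k::comm_ring_1) sym" where
  "internal_basis I J = Abs_poly_mapping (\<lambda>K. delta_coeff K I J)"

definition internal_prod ::
  "('c::semigroup_add, 'k::comm_ring_1) sym \<Rightarrow> ('c, 'k) sym \<Rightarrow> ('c, 'k) sym" where
  "internal_prod = bilin_ext internal_basis"

text \<open>
  The lists \<open>Is\<close> and \<open>Js\<close> have the same length for arguments taken from the same tensor power,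
  which is the only intended use.
\<close>

definition tensor_internal_prod ::
  "('c::semigroup_add, 'k::comm_ring_1) sym_tensors \<Rightarrow> ('c, 'k) sym_tensors
    \<Rightarrow> ('c, 'k) sym_tensors" where
  "tensor_internal_prod = bilin_ext (\<lambda>Is Js. pure_tensor (map2 internal_basis Is Js))"

end

(*
  The coefficient of S^K in S^I * S^J is the coefficient of the monomial x^I y^J in M_K(X x Y), where
  the rows carry I and the columns carry J: since M_K(X x Y) is quasi-symmetric in X and in Y, it is
  determined by its coefficients at such packed monomials. The pairs (r, s) are ordered
  lexicographically, so for an ordinal sum X = X' + X'' one has
  M_K(X x Y) = sum of M_K'(X' x Y) M_K''(X'' x Y) over all K = K' K''. Taking the coefficient of
  x^(I' I'') y^J distributes every column of J over the two factors, which is the coproduct of S^J.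
  This is the case r = 2 of the theorem on basis elements; the general case follows by bilinearity and
  induction on r.
*)
theory Submission
  imports Defs
begin

text \<open>The structure constants are defined as coordinates of M_K(X x Y) in the family of all
  M_I(X) M_J(Y), over a ring that need not be a field. Identifying them with coefficients at packed
  monomials takes three facts: the family is linearly independent, M_K(X x Y) agrees at every
  monomial with the candidate expansion, and this expansion is a finite sum. The last is where
  finiteness of the color decompositions enters. Infinite alphabets need not be manipulated
  directly: a monomial meets finitely many rows and columns, so each single coefficient is computed
  in a finite alphabet, where the recursion \<open>list_M\<close> replaces the sum over increasing
  positions. Splitting a column as i + j may leave a zero vector on either side, and the second
  block of rows does not start at row 0. Hence monomials with empty rows and columns are
  unavoidable, and quasi-symmetry is used in the form that deleting them does not change a
  coefficient; this is the counterpart of S_0 = 1.\<close>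

abbreviation (input) lookup where "lookup \<equiv> Poly_Mapping.lookup"
abbreviation (input) keys where "keys \<equiv> Poly_Mapping.keys"
abbreviation (input) single where "single \<equiv> Poly_Mapping.single"

section \<open>Linear extension and tensor powers\<close>

lemma lookup_fscale: "lookup (fscale c F) a = c * lookup F a"
  by (simp add: fscale_def Poly_Mapping.map.rep_eq when_def)

lemma fscale_single: "fscale c (single a d) = single a (c * d)"
  by (rule poly_mapping_eqI) (simp add: lookup_fscale lookup_single when_def)

lemma fscale_mult_left: "fscale c F * G = fscale c (F * G)"
  by (simp add: fscale_def mult_map_scale_conv_mult mult.assoc)

text \<open>Positions outside \<open>keys F\<close> carry coefficient 0. Larger index sets are
  needed because coefficients may cancel in a sum, whose keys can then be fewer than those of the
  summands.\<close>

lemma lin_ext_superset: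
  assumes "finite A" "keys F \<subseteq> A"
  shows "lin_ext f F = (\<Sum>a\<in>A. fscale (lookup F a) (f a))"
  unfolding lin_ext_def
  by (rule sum.mono_neutral_left)
     (use assms in \<open>auto simp: in_keys_iff poly_mapping_eq_iff lookup_fscale fun_eq_iff\<close>)

text \<open>A lightweight linearity predicate. Its purpose is \<open>flinear_eqI\<close>, by which
  multilinear identities are checked on basis elements, one argument at a time.\<close>

definition flinear :: "(('a \<Rightarrow>\<^sub>0 'k::comm_ring_1) \<Rightarrow> ('b \<Rightarrow>\<^sub>0 'k)) \<Rightarrow> bool" where
  "flinear g \<longleftrightarrow> (\<forall>F G. g (F + G) = g F + g G) \<and> (\<forall>c F. g (fscale c F) = fscale c (g F))"

lemma flinear_zero:
  assumes "flinear g"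
  shows "g 0 = 0"
proof -
  have "g (0 + 0) = g 0 + g 0"
    using assms unfolding flinear_def by blast
  then show ?thesis
    by simp
qed

lemma flinear_sum:
  assumes "flinear g"
  shows "g (\<Sum>x\<in>X. h x) = (\<Sum>x\<in>X. g (h x))"
  by (induction X rule: infinite_finite_induct)
     (use assms in \<open>auto simp: flinear_zero flinear_def\<close>)

lemma flinear_lin_ext_arg:
  assumes "flinear g"
  shows "g (lin_ext f F) = lin_ext (\<lambda>a. g (f a)) F"
  using assms by (simp add: lin_ext_def flinear_sum flinear_def)

lemma lin_ext_single: "lin_ext f (single a c) = fscale c (f a)"
  by (subst lin_ext_superset[of "{a}"]) auto

lemma lin_ext_basis: "lin_ext (\<lambda>a. single a 1) F = F"
proof (rule poly_mapping_eqI)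
  fix k
  have "lookup (lin_ext (\<lambda>a. single a 1) F) k = (\<Sum>a\<in>keys F. if a = k then lookup F k else 0)"
    unfolding lin_ext_def lookup_sum lookup_fscale lookup_single when_def by (intro sum.cong) auto
  then show "lookup (lin_ext (\<lambda>a. single a 1) F) k = lookup F k"
    by (simp add: in_keys_iff)
qed

lemma flinear_expand:
  assumes "flinear g"
  shows "g F = lin_ext (\<lambda>a. g (single a 1)) F"
  using flinear_lin_ext_arg[OF assms, of "\<lambda>a. single a 1" F] by (simp add: lin_ext_basis)

lemma flinear_eqI:
  assumes "flinear g" "flinear h" "\<And>a. g (single a 1) = h (single a 1)"
  shows "g F = h F"
  using flinear_expand[OF assms(1), of F] flinear_expand[OF assms(2), of F] assms(3) by simp

lemma fscale_add: "fscale c (F + G) = fscale c F + fscale c G"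
  by (rule poly_mapping_eqI) (simp add: lookup_fscale lookup_add algebra_simps)

lemma fscale_add_left: "fscale (c + d) F = fscale c F + fscale d F"
  by (rule poly_mapping_eqI) (simp add: lookup_fscale lookup_add algebra_simps)

lemma fscale_fscale: "fscale c (fscale d F) = fscale (c * d) F"
  by (rule poly_mapping_eqI) (simp add: lookup_fscale algebra_simps)

lemma fscale_one: "fscale 1 F = F"
  by (rule poly_mapping_eqI) (simp add: lookup_fscale)

lemma fscale_zero: "fscale c 0 = 0"
  by (rule poly_mapping_eqI) (simp add: lookup_fscale)

lemma fscale_sum: "fscale c (\<Sum>x\<in>X. h x) = (\<Sum>x\<in>X. fscale c (h x))"
  by (induction X rule: infinite_finite_induct) (simp_all add: fscale_add fscale_zero)

lemma flinear_lin_ext: "flinear (lin_ext f)"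
  unfolding flinear_def
proof (intro conjI allI)
  fix F G
  show "lin_ext f (F + G) = lin_ext f F + lin_ext f G"
    by (subst (1 2 3) lin_ext_superset[of "keys F \<union> keys G"])
       (use keys_add[of F G] in \<open>auto simp: lookup_add fscale_add_left sum.distrib\<close>)
next
  fix c F
  show "lin_ext f (fscale c F) = fscale c (lin_ext f F)"
    by (subst (1 2) lin_ext_superset[of "keys F"])
       (auto simp: lookup_fscale in_keys_iff fscale_fscale fscale_sum)
qed

lemma flinear_lin_ext_fun:
  assumes "\<And>a. flinear (h a)"
  shows "flinear (\<lambda>G. lin_ext (\<lambda>a. h a G) F)"
  using assms
  by (auto simp: flinear_def lin_ext_def fscale_add sum.distrib fscale_fscale fscale_sum mult.commute)

lemma flinear_comp: "flinear g \<Longrightarrow> flinear h \<Longrightarrow> flinear (\<lambda>F. g (h F))"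
  by (simp add: flinear_def)

lemma flinear_mult_right: "flinear (\<lambda>F. F * G)"
  by (simp add: flinear_def fscale_mult_left distrib_right)

text \<open>Scaling by \<open>c\<close> is left multiplication by \<open>single 0 c\<close>. Right
  multiplication is thus linear by associativity, whereas here \<open>single 0 c\<close> has to be
  moved past \<open>F\<close>: it commutes with each \<open>single a d\<close>, and \<open>F\<close>
  is a sum of such terms.\<close>

lemma flinear_mult_left:
  fixes F :: "'a::monoid_add \<Rightarrow>\<^sub>0 'k::comm_ring_1"
  shows "flinear (\<lambda>G. F * G)"
proof -
  have "F * fscale c G = fscale c (F * G)" for c G
  proof -
    have "single a d * fscale c G = fscale c (single a d * G)" for a d
    proof -
      have "single a d * fscale c G = (single a d * single 0 c) * G"
        by (simp add: fscale_def mult_map_scale_conv_mult mult.assoc)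
      also have "\<dots> = (single 0 c * single a d) * G"
        by (simp add: mult_single mult.commute)
      finally show ?thesis
        by (simp add: fscale_def mult_map_scale_conv_mult mult.assoc)
    qed
    moreover have "F = (\<Sum>a\<in>keys F. single a (lookup F a))"
      using lin_ext_basis[of F] by (simp add: lin_ext_def fscale_single)
    ultimately show ?thesis
      by (metis (no_types, lifting) fscale_sum sum.cong sum_distrib_right)
  qed
  then show ?thesis
    by (simp add: flinear_def distrib_left)
qed

lemma flinear_bilin_ext_left: "flinear (\<lambda>F. bilin_ext f F G)"
  by (simp add: bilin_ext_def flinear_lin_ext)

lemma flinear_bilin_ext_right: "flinear (bilin_ext f F)"
  unfolding bilin_ext_def by (intro flinear_lin_ext_fun flinear_lin_ext)

lemma bilin_ext_single: "bilin_ext f (single a 1) (single b 1) = f a b"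
  by (simp add: bilin_ext_def lin_ext_single fscale_one)

lemmas flinear_intros = flinear_lin_ext flinear_lin_ext_fun flinear_mult_left flinear_mult_right
  flinear_bilin_ext_left flinear_bilin_ext_right

section \<open>Tensor powers, and the reduction of r factors to two\<close>

lemma tensor_mult_cons: "tensor_mult (tensor_cons F P) = F * tensor_mult P"
proof (rule flinear_eqI[where F = F])
  fix I
  show "tensor_mult (tensor_cons (single I 1) P) = single I 1 * tensor_mult P"
    by (rule flinear_eqI[where F = P])
       (auto simp: tensor_mult_def tensor_cons_def bilin_ext_single lin_ext_single fscale_one
          Sbasis_def intro!: flinear_intros flinear_comp[OF flinear_lin_ext flinear_bilin_ext_right]
          flinear_comp[OF flinear_mult_left])
qed (auto simp: tensor_mult_def tensor_cons_def
       intro!: flinear_intros flinear_comp[OF flinear_lin_ext flinear_bilin_ext_left])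

text \<open>On basis elements, \<open>map2\<close> of two nonempty lists is a cons whatever the
  tails are; the rest is linearity in four arguments.\<close>

lemma tensor_internal_prod_cons:
  "tensor_internal_prod (tensor_cons F P) (tensor_cons G Q) =
     tensor_cons (internal_prod F G) (tensor_internal_prod P Q)" (is "?L F G P Q = ?R F G P Q")
proof -
  note lin = flinear_comp[OF flinear_bilin_ext_left] flinear_comp[OF flinear_bilin_ext_right]
    flinear_bilin_ext_left flinear_bilin_ext_right
  note defs = tensor_internal_prod_def tensor_cons_def internal_prod_def
  have *: "?L (single I 1) (single J 1) (single Is 1) (single Js 1) =
      ?R (single I 1) (single J 1) (single Is 1) (single Js 1)" for I J Is Js
    by (simp add: defs pure_tensor_def bilin_ext_single)
  have "?L (single I 1) (single J 1) (single Is 1) Q =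
      ?R (single I 1) (single J 1) (single Is 1) Q" for I J Is
    using * by (rule flinear_eqI[where F = Q, rotated 2]) (unfold defs, auto intro!: lin)
  then have "?L (single I 1) (single J 1) P Q = ?R (single I 1) (single J 1) P Q" for I J
    by (rule flinear_eqI[where F = P, rotated 2]) (unfold defs, auto intro!: lin)
  then have "?L (single I 1) G P Q = ?R (single I 1) G P Q" for I
    by (rule flinear_eqI[where F = G, rotated 2]) (unfold defs, auto intro!: lin)
  then show ?thesis
    by (rule flinear_eqI[where F = F, rotated 2]) (unfold defs, auto intro!: lin)
qed

lemma tensor_internal_prod_unit: "tensor_internal_prod (single [] c) (single [] d) = single [] (c * d)"
  by (simp add: tensor_internal_prod_def bilin_ext_def lin_ext_single pure_tensor_def
      fscale_fscale fscale_single)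

lemma internal_prod_mult:
  fixes F F' G :: "('c::semigroup_add, 'k::comm_ring_1) sym"
  assumes basis: "\<And>I I' J :: 'c vcomp. (internal_basis (I + I') J :: ('c, 'k) sym) =
     lin_ext (\<lambda>(J', J''). internal_basis I J' * internal_basis I' J'') (coproduct (Sbasis J))"
  shows "internal_prod (F * F') G =
     lin_ext (\<lambda>(J', J''). internal_prod F (Sbasis J') * internal_prod F' (Sbasis J'')) (coproduct G)"
    (is "?L F F' G = ?R F F' G")
proof -
  have *: "flinear (\<lambda>F. ?L F F' G)" "flinear (\<lambda>F'. ?L F F' G)" "flinear (\<lambda>G. ?L F F' G)" 
          "flinear (\<lambda>F. ?R F F' G)" "flinear (\<lambda>F'. ?R F F' G)" "flinear (\<lambda>G. ?R F F' G)" for F F' G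
    unfolding internal_prod_def coproduct_def case_prod_beta
    by (intro flinear_comp[OF flinear_bilin_ext_left flinear_mult_left] 
        flinear_comp[OF flinear_bilin_ext_left flinear_mult_right] flinear_bilin_ext_right
        flinear_comp[OF flinear_mult_left flinear_bilin_ext_left]
        flinear_comp[OF flinear_mult_right flinear_bilin_ext_left] flinear_lin_ext_fun
        flinear_comp[OF flinear_lin_ext flinear_lin_ext])+
  have "?L (single I 1) (single I' 1) (single J 1) = ?R (single I 1) (single I' 1) (single J 1)" for I I' J
    using basis[of I I' J]
    by (simp add: internal_prod_def mult_single Sbasis_def bilin_ext_single cong: if_cong)
  then have "?L (single I 1) (single I' 1) G = ?R (single I 1) (single I' 1) G" for I I'
    by (rule flinear_eqI[where F = G, rotated 2]) (rule *)+
  then have "?L (single I 1) F' G = ?R (single I 1) F' G" for I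
    by (rule flinear_eqI[where F = F', rotated 2]) (rule *)+
  then show ?thesis
    by (rule flinear_eqI[where F = F, rotated 2]) (rule *)+
qed

text \<open>Induction splits off the first factor. The step of \<open>iterated_coproduct\<close>
  starts from r = 1, so r = 0 and r = 1 are treated separately: the former is the counit rule
  \<open>unit\<close>, the latter only multiplies by the empty product.\<close>

lemma internal_prod_prod_list:
  fixes Fs :: "('c::semigroup_add, 'k::comm_ring_1) sym list"
  assumes unit: "\<And>G :: ('c, 'k) sym. internal_prod 1 G = single 0 (lookup G 0)"
    and mult: "\<And>F F' G :: ('c, 'k) sym. internal_prod (F * F') G =
     lin_ext (\<lambda>(J', J''). internal_prod F (Sbasis J') * internal_prod F' (Sbasis J'')) (coproduct G)"
  shows "internal_prod (prod_list Fs) G =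
    tensor_mult (tensor_internal_prod (pure_tensor Fs) (iterated_coproduct (length Fs) G))"
proof (induction Fs arbitrary: G)
  case Nil
  have "fscale (lookup G 0) 1 = (single 0 (lookup G 0) :: ('c, 'k) sym)"
    using fscale_single[of "lookup G 0" 0 1] by simp
  then show ?case
    by (simp add: unit pure_tensor_def tensor_internal_prod_unit tensor_mult_def lin_ext_single)
next
  case (Cons F Fs)
  have pt: "pure_tensor (F # Fs) = tensor_cons F (pure_tensor Fs)" for F :: "('c, 'k) sym" and Fs
    by (simp add: pure_tensor_def)
  show ?case
  proof (cases Fs)
    case Nil
    have "tensor_mult (tensor_internal_prod (pure_tensor []) (pure_tensor [])) = (1 :: ('c, 'k) sym)"
      by (simp add: pure_tensor_def tensor_internal_prod_unit tensor_mult_def lin_ext_single fscale_one)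
    then show ?thesis
      by (simp add: Nil pt tensor_internal_prod_cons tensor_mult_cons)
  next
    case (Cons F' Fs')
    have lin: "flinear (\<lambda>Q. tensor_mult (tensor_internal_prod P Q))" for P :: "('c, 'k) sym_tensors"
      unfolding tensor_mult_def tensor_internal_prod_def
      by (intro flinear_comp[OF flinear_lin_ext flinear_bilin_ext_right])
    have len: "length (F # Fs) = Suc (Suc (length Fs'))" "length Fs = Suc (length Fs')"
      by (simp_all add: Cons)
    \<comment> \<open>For r >= 2 the coproduct of \<open>G\<close> is outermost in
      \<open>iterated_coproduct\<close>, so linearity moves everything inside its sum, and the
      induction hypothesis applies to each second tensor factor.\<close>
    show ?thesis
      unfolding len(1) iterated_coproduct.simps flinear_lin_ext_arg[OF lin] pt case_prod_beta
        tensor_internal_prod_cons tensor_mult_cons Cons.IH[unfolded len(2), symmetric]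
      by (simp add: mult case_prod_unfold)
  qed
qed

section \<open>Quasi-symmetric functions over finite alphabets\<close>

lemma mcoeff_Mps [simp]: "mcoeff (Mps f) m = f m"
  by (simp add: Mps_inverse)

lemma mcoeff_sum: "mcoeff (sum f X) m = (\<Sum>x\<in>X. mcoeff (f x) m)"
  by (induction X rule: infinite_finite_induct) (simp_all add: mcoeff_simps)

lemma mcoeff_mult_nonzeroE:
  assumes "mcoeff (f * g) m \<noteq> 0"
  obtains a b where "m = a + b" "mcoeff f a \<noteq> 0" "mcoeff g b \<noteq> 0"
proof -
  from assms obtain p where "p \<in> {(a, b). a + b = m}" "(case p of (a, b) \<Rightarrow> mcoeff f a * mcoeff g b) \<noteq> 0"
    unfolding mcoeff_simps by (meson sum.neutral)
  then show thesis
    by (intro that[of "fst p" "snd p"]) (auto simp: split_def)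
qed

definition monom :: "('v \<Rightarrow>\<^sub>0 nat) \<Rightarrow> ('v, 'k::comm_ring_1) mps" where
  "monom a = Mps (\<lambda>m. if m = a then 1 else 0)"

lemma mcoeff_monom: "mcoeff (monom a) m = (if m = a then 1 else 0)"
  by (simp add: monom_def)

lemma mvar_eq_monom: "mvar v = monom (single v 1)"
  by (simp add: mvar_def monom_def)

lemma monom_0: "monom 0 = 1"
  by (rule mps_eqI) (simp add: mcoeff_monom mcoeff_simps)

lemma mcoeff_monom_mult: "mcoeff (monom a * f) (a + m) = mcoeff f m"
proof -
  have "mcoeff (monom a * f) (a + m) =
      (\<Sum>(x, y)\<in>{(a, m)}. mcoeff (monom a) x * mcoeff f y)"
    unfolding mcoeff_simps
    by (rule sum.mono_neutral_right) (auto simp: finite_decompositions mcoeff_monom split: if_splits)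
  then show ?thesis
    by (simp add: mcoeff_monom)
qed

lemma mcoeff_monom_mult_nonzeroE:
  assumes "mcoeff (monom a * f) m \<noteq> 0"
  obtains b where "m = a + b" "mcoeff f b \<noteq> 0"
  using assms by (elim mcoeff_mult_nonzeroE) (auto simp: mcoeff_monom split: if_splits)

lemma monom_mult: "monom a * monom b = monom (a + b)"
proof (rule mps_eqI)
  fix m
  show "mcoeff (monom a * monom b) m = mcoeff (monom (a + b)) m"
  proof (cases "\<exists>c. m = a + c")
    case True
    then show ?thesis
      by (auto simp: mcoeff_monom_mult mcoeff_monom)
  next
    case False
    then have "mcoeff (monom a * monom b) m = 0"
      using mcoeff_monom_mult_nonzeroE by metis
    with False show ?thesis
      by (auto simp: mcoeff_monom)
  qed
qed

text \<open>The function M_ns of the finite alphabet with positions \<open>js\<close>, listed in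
  increasing order, where \<open>f j n\<close> plays the part of x_j^n. The recursion decides
  whether the first position is skipped or takes the first vector.\<close>

fun list_M :: "('j \<Rightarrow> 'n \<Rightarrow> 'r::comm_semiring_1) \<Rightarrow> 'j list \<Rightarrow> 'n list \<Rightarrow> 'r" where
  "list_M f [] ns = (if ns = [] then 1 else 0)"
| "list_M f (j # js) [] = 1"
| "list_M f (j # js) (n # ns) = list_M f js (n # ns) + f j n * list_M f js ns"

lemma list_M_Nil2 [simp]: "list_M f js [] = 1"
  by (cases js) auto

text \<open>A choice of positions from \<open>xs @ ys\<close> is a choice from \<open>xs\<close>
  followed by one from \<open>ys\<close>; \<open>t\<close> counts those taken from
  \<open>xs\<close>.\<close>

lemma list_M_append:
  "list_M f (xs @ ys) ns = (\<Sum>t\<le>length ns. list_M f xs (take t ns) * list_M f ys (drop t ns))"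
proof (induction xs arbitrary: ns)
  case Nil
  have "(\<Sum>t\<le>length ns. list_M f [] (take t ns) * list_M f ys (drop t ns)) =
      (\<Sum>t\<in>{0}. list_M f [] (take t ns) * list_M f ys (drop t ns))"
    by (rule sum.mono_neutral_right) auto
  then show ?case
    by simp
next
  case (Cons x xs)
  show ?case
  proof (cases ns)
    case [simp]: (Cons n ns')
    have *: "list_M f (xs @ ys) (n # ns') = list_M f ys (n # ns') +
        (\<Sum>t\<le>length ns'. list_M f xs (n # take t ns') * list_M f ys (drop t ns'))"
      using Cons.IH[of ns] by (simp add: sum.atMost_Suc_shift del: sum.atMost_Suc)
    show ?thesis
      by (simp del: sum.atMost_Suc add: sum.atMost_Suc_shift sum.distrib sum_distrib_left * Cons.IH[of ns'] algebra_simps)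
  qed simp
qed

lemma list_M_map: "list_M f (map g xs) ns = list_M (\<lambda>j. f (g j)) xs ns"
  by (induction "\<lambda>j. f (g j)" xs ns rule: list_M.induct) auto

lemma list_M_hom:
  assumes "h 0 = 0" "h 1 = 1" "\<And>a b. h (a + b) = h a + h b" "\<And>a b. h (a * b) = h a * h b"
  shows "h (list_M f xs ns) = list_M (\<lambda>j n. h (f j n)) xs ns"
  by (induction f xs ns rule: list_M.induct) (simp_all add: assms)

text \<open>As \<open>x\<close> is the smallest position, a strictly increasing list over
  \<open>x # xs\<close> either avoids \<open>x\<close> or begins with it; these are the two branches
  of the recursion.\<close>

lemma list_M_eq_sum:
  fixes xs :: "'j::linorder list" and ns :: "'n list"
  assumes "sorted_wrt (<) xs"
  shows "list_M f xs ns =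
    (\<Sum>js | sorted_wrt (<) js \<and> length js = length ns \<and> set js \<subseteq> set xs. prod_list (map2 f js ns))"
  using assms
proof (induction xs arbitrary: ns)
  case Nil
  have *: "{js :: 'j list. sorted_wrt (<) js \<and> length js = length ns \<and> set js \<subseteq> set []} =
      (if ns = [] then {[]} else {})"
    by auto
  show ?case
    unfolding * by simp
next
  case (Cons x xs)
  let ?S = "\<lambda>xs ns. {js. sorted_wrt (<) js \<and> length js = length ns \<and> set js \<subseteq> set xs}"
  have fin: "finite (?S xs ns)" for xs :: "'j list" and ns :: "'n list"
    by (rule finite_subset[OF _ finite_lists_length_eq[of "set xs" "length ns"]]) auto
  show ?case
  proof (cases ns)
    case Nil
    have "?S (x # xs) [] = {[]}"
      by auto
    with Nil show ?thesis
      by simp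
  next
    case ns: (Cons n ns')
    have less: "x < y" if "y \<in> set xs" for y
      using Cons.prems that by simp
    have "?S (x # xs) ns \<subseteq> ?S xs ns \<union> Cons x ` ?S xs ns'"
    proof
      fix js
      assume js: "js \<in> ?S (x # xs) ns"
      then obtain j js' where js': "js = j # js'"
        using ns by (cases js) auto
      have js'_sub: "set js' \<subseteq> set xs"
      proof
        fix y
        assume y: "y \<in> set js'"
        then have "j < y" "j = x \<or> j \<in> set xs" "y = x \<or> y \<in> set xs"
          using js js' by auto
        then show "y \<in> set xs"
          using less by (auto dest: order.strict_trans)
      qed
      then show "js \<in> ?S xs ns \<union> Cons x ` ?S xs ns'"
        using js js' ns by (cases "j = x") auto
    qed
    moreover have "?S xs ns \<union> Cons x ` ?S xs ns' \<subseteq> ?S (x # xs) ns"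
      using less ns by fastforce
    ultimately have union: "?S (x # xs) ns = ?S xs ns \<union> Cons x ` ?S xs ns'"
      by (rule antisym)
    have disjoint: "?S xs ns \<inter> Cons x ` ?S xs ns' = {}"
      using less by fastforce
    have "(\<Sum>js\<in>?S (x # xs) ns. prod_list (map2 f js ns)) =
        (\<Sum>js\<in>?S xs ns. prod_list (map2 f js ns)) +
        (\<Sum>js\<in>Cons x ` ?S xs ns'. prod_list (map2 f js ns))"
      unfolding union by (rule sum.union_disjoint[OF fin finite_imageI[OF fin] disjoint])
    also have "\<dots> = list_M f xs ns + f x n * list_M f xs ns'"
      using Cons.prems by (simp add: Cons.IH sum.reindex sum_distrib_left ns)
    finally show ?thesis
      by (simp add: ns)
  qed
qed

text \<open>Bridge from the coefficientwise infinite sum to a finite alphabet: the second assumption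
  says that only position lists inside \<open>xs\<close> can produce the monomial
  \<open>m\<close>.\<close>

lemma mcoeff_qsym_M:
  assumes "sorted_wrt (<) xs"
    and "\<And>js. length js = length (columns I) \<Longrightarrow>
      mcoeff (prod_list (map2 (alphabet_power A) js (columns I))) m \<noteq> 0 \<Longrightarrow> set js \<subseteq> set xs"
  shows "mcoeff (qsym_M I A) m = mcoeff (list_M (alphabet_power A) xs (columns I)) m"
proof -
  let ?c = "\<lambda>js. mcoeff (prod_list (map2 (alphabet_power A) js (columns I))) m"
  let ?S = "{js. sorted_wrt (<) js \<and> length js = length (columns I) \<and> set js \<subseteq> set xs}"
  have "finite ?S"
    by (rule finite_subset[OF _ finite_lists_length_eq[of "set xs" "length (columns I)"]]) auto
  then have "mcoeff (qsym_M I A) m =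
      (\<Sum>js\<in>?S. if sorted_wrt (<) js \<and> length js = length (columns I) then ?c js else 0)"
    unfolding qsym_M_def mcoeff_Mps
    by (rule Sum_any.expand_superset) (use assms(2) in \<open>auto split: if_splits\<close>)
  also have "\<dots> = mcoeff (list_M (alphabet_power A) xs (columns I)) m"
    by (simp add: list_M_eq_sum[OF assms(1)] mcoeff_sum)
  finally show ?thesis .
qed

section \<open>Degree, rows, columns and colors of the monomials in M_K(X x Y)\<close>

definition mdeg :: "('v \<Rightarrow>\<^sub>0 nat) \<Rightarrow> nat" where
  "mdeg m = (\<Sum>v\<in>keys m. lookup m v)"

lemma keys_add_nat: "keys (a + b) = keys a \<union> keys (b :: 'v \<Rightarrow>\<^sub>0 nat)"
  by (auto simp: in_keys_iff lookup_add)

lemma mdeg_add: "mdeg (a + b) = mdeg a + mdeg b"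
proof -
  have *: "mdeg m = (\<Sum>v\<in>keys a \<union> keys b. lookup m v)" if "keys m \<subseteq> keys a \<union> keys b" for m
    unfolding mdeg_def by (rule sum.mono_neutral_left) (use that in \<open>auto simp: in_keys_iff\<close>)
  show ?thesis
    by (simp add: * keys_add_nat lookup_add sum.distrib)
qed

lemma mdeg_0 [simp]: "mdeg 0 = 0"
  by (simp add: mdeg_def)

lemma mdeg_single [simp]: "mdeg (single v k) = k"
  by (simp add: mdeg_def)

lemma lookup_le_mdeg: "lookup m v \<le> mdeg m"
  unfolding mdeg_def by (cases "v \<in> keys m") (auto simp: in_keys_iff intro: member_le_sum)

lemma mdeg_eq_0_iff [simp]: "mdeg m = 0 \<longleftrightarrow> m = 0"
  using lookup_le_mdeg[of m] by (auto intro!: poly_mapping_eqI)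

definition rows :: "('c xyvar \<Rightarrow>\<^sub>0 nat) \<Rightarrow> nat set" where
  "rows m = {r. \<exists>c. Inl (r, c) \<in> keys m}"

definition cols :: "('c xyvar \<Rightarrow>\<^sub>0 nat) \<Rightarrow> nat set" where
  "cols m = {s. \<exists>c. Inr (s, c) \<in> keys m}"

lemma finite_rows [simp]: "finite (rows m)"
proof -
  have "rows m \<subseteq> (\<lambda>v. case v of Inl x \<Rightarrow> fst x) ` keys m"
    by (force simp: rows_def)
  then show ?thesis
    by (rule finite_subset) simp
qed

lemma finite_cols [simp]: "finite (cols m)"
proof -
  have "cols m \<subseteq> (\<lambda>v. case v of Inr x \<Rightarrow> fst x) ` keys m"
    by (force simp: cols_def)
  then show ?thesis
    by (rule finite_subset) simp
qed

lemma rows_add [simp]: "rows (a + b) = rows a \<union> rows b"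
  and cols_add [simp]: "cols (a + b) = cols a \<union> cols b"
  by (auto simp: rows_def cols_def keys_add_nat)

lemma rows_0 [simp]: "rows 0 = {}" and cols_0 [simp]: "cols 0 = {}"
  by (auto simp: rows_def cols_def)

text \<open>The monomials \<open>m\<close> which can occur in a product of powers of the variables
  \<open>t\<^sub>j\<^sup>(\<^sup>\<gamma>\<^sup>)\<close> with positions \<open>j \<in> P\<close> and with total color content \<open>N\<close>.\<close>

definition xy_content ::
  "(nat \<times> nat) set \<Rightarrow> ('c::semigroup_add \<Rightarrow>\<^sub>0 nat) \<Rightarrow> ('c xyvar \<Rightarrow>\<^sub>0 nat) \<Rightarrow> bool" where
  "xy_content P N m \<longleftrightarrow> rows m = fst ` P \<and> cols m = snd ` P \<and> mdeg m = 2 * mdeg N \<and>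
    (\<forall>\<gamma>\<in>keys N. \<exists>r s \<alpha> \<beta>. Inl (r, \<alpha>) \<in> keys m \<and> Inr (s, \<beta>) \<in> keys m \<and> \<alpha> + \<beta> = \<gamma>) \<and>
    (\<forall>r \<alpha>. Inl (r, \<alpha>) \<in> keys m \<longrightarrow> (\<exists>\<beta>. \<alpha> + \<beta> \<in> keys N)) \<and>
    (\<forall>s \<beta>. Inr (s, \<beta>) \<in> keys m \<longrightarrow> (\<exists>\<alpha>. \<alpha> + \<beta> \<in> keys N))"

lemma xy_content_0: "xy_content {} 0 0"
  by (simp add: xy_content_def)

text \<open>Each condition is compatible with union of positions and addition of contents and
  monomials, so the description passes through all the products from which M_K(X x Y) is
  built.\<close>

lemma xy_content_add:
  "xy_content P N m \<Longrightarrow> xy_content P' N' m' \<Longrightarrow> xy_content (P \<union> P') (N + N') (m + m')"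
  unfolding xy_content_def rows_add cols_add keys_add_nat mdeg_add image_Un ball_Un
  by (elim conjE, intro conjI; (simp; fail)?; unfold Un_iff; meson)

text \<open>Every term of \<open>alph_XY j \<gamma>\<close> is one x variable times one y variable,
  which accounts for the factor 2 in the degree condition.\<close>

lemma xy_content_alph_XY:
  fixes j :: "nat \<times> nat" and \<gamma> :: "'c::semigroup_add"
  assumes "mcoeff (alph_XY j \<gamma> :: ('c xyvar, 'k::comm_ring_1) mps) m \<noteq> 0"
  shows "xy_content {j} (single \<gamma> 1) m"
proof -
  obtain r s where [simp]: "j = (r, s)"
    by (cases j)
  from assms have "(\<Sum>(\<alpha>, \<beta>)\<in>{(\<alpha>, \<beta>). \<alpha> + \<beta> = \<gamma>}. mcoeff (alph_X r \<alpha> * alph_Y s \<beta> :: ('c xyvar, 'k) mps) m) \<noteq> 0"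
    by (simp add: alph_XY_def mcoeff_sum case_prod_unfold)
  then obtain p where "p \<in> {(\<alpha>, \<beta>). \<alpha> + \<beta> = \<gamma>}"
    "(case p of (\<alpha>, \<beta>) \<Rightarrow> mcoeff (alph_X r \<alpha> * alph_Y s \<beta> :: ('c xyvar, 'k) mps) m) \<noteq> 0"
    by (rule sum.not_neutral_contains_not_neutral)
  then obtain \<alpha> \<beta> where "\<alpha> + \<beta> = \<gamma>" "mcoeff (alph_X r \<alpha> * alph_Y s \<beta> :: ('c xyvar, 'k) mps) m \<noteq> 0"
    by (cases p) auto
  moreover from this have "m = single (Inl (r, \<alpha>)) 1 + single (Inr (s, \<beta>)) 1"
    by (auto simp: alph_X_def alph_Y_def mvar_eq_monom monom_mult mcoeff_monom split: if_splits)
  ultimately  show ?thesis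
    by (auto simp: xy_content_def mdeg_add keys_add_nat rows_def cols_def)
qed

lemma xy_content_power:
  fixes j :: "nat \<times> nat" and \<gamma> :: "'c::semigroup_add"
  shows "mcoeff (alph_XY j \<gamma> ^ k :: ('c xyvar, 'k::comm_ring_1) mps) m \<noteq> 0 \<Longrightarrow> xy_content (if k = 0 then {} else {j}) (single \<gamma> k) m"
proof (induction k arbitrary: m)
  case 0
  then show ?case
    by (auto simp: mcoeff_simps xy_content_0 split: if_splits)
next
  case (Suc k)
  from Suc.prems[unfolded power_Suc] obtain a b where m: "m = a + b" and
    "mcoeff (alph_XY j \<gamma> :: ('c xyvar, 'k) mps) a \<noteq> 0" "mcoeff (alph_XY j \<gamma> ^ k :: ('c xyvar, 'k) mps) b \<noteq> 0"
    by (rule mcoeff_mult_nonzeroE) blast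
  with xy_content_add[OF xy_content_alph_XY Suc.IH] have
    "xy_content ({j} \<union> (if k = 0 then {} else {j})) (single \<gamma> 1 + single \<gamma> k) m"
    by blast
  then show ?case
    by (auto simp flip: single_add split: if_splits)
qed

lemma poly_mapping_sum_single: "(\<Sum>c\<in>keys n. single c (lookup n c)) = (n :: 'c \<Rightarrow>\<^sub>0 nat)"
proof (rule poly_mapping_eqI)
  fix d
  have "lookup (\<Sum>c\<in>keys n. single c (lookup n c)) d = (\<Sum>c\<in>keys n. if c = d then lookup n d else 0)"
    unfolding lookup_sum lookup_single when_def by (intro sum.cong) auto
  then show "lookup (\<Sum>c\<in>keys n. single c (lookup n c)) d = lookup n d"
    by (simp add: in_keys_iff)
qed

lemma xy_content_alphabet_power:
  fixes n :: "'c::semigroup_add \<Rightarrow>\<^sub>0 nat"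
  assumes "mcoeff (alphabet_power alph_XY j n :: ('c xyvar, 'k::comm_ring_1) mps) m \<noteq> 0" "n \<noteq> 0"
  shows "xy_content {j} n m"
proof -
  have "xy_content (if S = {} then {} else {j}) (\<Sum>c\<in>S. single c (lookup n c)) m"
    if "finite S" "S \<subseteq> keys n" "mcoeff (\<Prod>c\<in>S. alph_XY j c ^ lookup n c :: ('c xyvar, 'k) mps) m \<noteq> 0" for S
    using that
  proof (induction S arbitrary: m rule: finite_induct)
    case empty
    then show ?case
      by (auto simp: mcoeff_simps xy_content_0 split: if_splits)
  next
    case (insert c S)
    from insert.prems(2)[unfolded prod.insert[OF insert.hyps]]
    obtain a b where m: "m = a + b" and a: "mcoeff (alph_XY j c ^ lookup n c :: ('c xyvar, 'k) mps) a \<noteq> 0"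
      and b: "mcoeff (\<Prod>c\<in>S. alph_XY j c ^ lookup n c :: ('c xyvar, 'k) mps) b \<noteq> 0"
      by (rule mcoeff_mult_nonzeroE) blast
    have "xy_content (if S = {} then {} else {j}) (\<Sum>c\<in>S. single c (lookup n c)) b"
      using insert.IH[OF _ b] insert.prems by simp
    from xy_content_add[OF xy_content_power[OF a] this]
    show ?case
      using insert by (auto simp: m in_keys_iff split: if_splits)
  qed
  from this[of "keys n"] assms show ?thesis
    by (auto simp: alphabet_power_def poly_mapping_sum_single split: if_splits)
qed

lemma xy_content_prod_list:
  fixes ns :: "('c::semigroup_add \<Rightarrow>\<^sub>0 nat) list"
  assumes "length js = length ns" "0 \<notin> set ns"
    and "mcoeff (prod_list (map2 (alphabet_power alph_XY) js ns) :: ('c xyvar, 'k::comm_ring_1) mps) m \<noteq> 0"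
  shows "xy_content (set js) (sum_list ns) m"
  using assms
proof (induction js ns arbitrary: m rule: list_induct2)
  case Nil
  then show ?case
    by (auto simp: mcoeff_simps xy_content_0 split: if_splits)
next
  case (Cons j js n ns)
  from Cons.prems(2) have "mcoeff (alphabet_power alph_XY j n * prod_list (map2 (alphabet_power alph_XY) js ns) :: ('c xyvar, 'k) mps) m \<noteq> 0"
    by simp
  then obtain a b where m: "m = a + b" and a: "mcoeff (alphabet_power alph_XY j n :: ('c xyvar, 'k) mps) a \<noteq> 0"
    and b: "mcoeff (prod_list (map2 (alphabet_power alph_XY) js ns) :: ('c xyvar, 'k) mps) b \<noteq> 0"
    by (rule mcoeff_mult_nonzeroE) blast
  show ?case
    using xy_content_add[OF xy_content_alphabet_power[OF a] Cons.IH[OF _ b]] Cons.prems(1)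
    by (simp add: m)
qed

lemma xy_content_list_M:
  fixes ns :: "('c::semigroup_add \<Rightarrow>\<^sub>0 nat) list"
  assumes "mcoeff (list_M (alphabet_power alph_XY) xs ns :: ('c xyvar, 'k::comm_ring_1) mps) m \<noteq> 0" "0 \<notin> set ns"
  shows "\<exists>P\<subseteq>set xs. xy_content P (sum_list ns) m"
  using assms
proof (induction xs arbitrary: ns m)
  case Nil
  then show ?case
    by (auto simp: mcoeff_simps xy_content_0 split: if_splits)
next
  case (Cons j js)
  show ?case
  proof (cases ns)
    case Nil
    with Cons.prems have "m = 0"
      by (auto simp: mcoeff_simps split: if_splits)
    with Nil show ?thesis
      using xy_content_0 by auto
  next
    case ns: (Cons n ns')
    show ?thesis
    proof (cases "mcoeff (list_M (alphabet_power alph_XY) js ns :: ('c xyvar, 'k) mps) m = 0")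
      case True
      with Cons.prems ns
      have "mcoeff (alphabet_power alph_XY j n * list_M (alphabet_power alph_XY) js ns' :: ('c xyvar, 'k) mps) m \<noteq> 0"
        by (simp add: mcoeff_simps(3))
      then obtain a b where m: "m = a + b"
        and a: "mcoeff (alphabet_power alph_XY j n :: ('c xyvar, 'k) mps) a \<noteq> 0"
        and b: "mcoeff (list_M (alphabet_power alph_XY) js ns' :: ('c xyvar, 'k) mps) b \<noteq> 0"
        by (rule mcoeff_mult_nonzeroE) blast
      from Cons.IH[OF b] Cons.prems ns obtain P where P: "P \<subseteq> set js" "xy_content P (sum_list ns') b"
        by auto
      show ?thesis
        using xy_content_add[OF xy_content_alphabet_power[OF a] P(2)] P(1) m Cons.prems(2) ns
        by (intro exI[of _ "{j} \<union> P"]) auto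
    next
      case False
      from Cons.IH[OF this Cons.prems(2)] show ?thesis
        by auto
    qed
  qed
qed

text \<open>A contributing position list uses exactly the rows and the columns of \<open>m\<close>,
  so it lies in their product; an increasing list covering this rectangle is a large enough
  alphabet.\<close>

lemma mcoeff_qsym_delta:
  fixes K :: "'c::semigroup_add vcomp"
  assumes "sorted_wrt (<) xs" "rows m \<times> cols m \<subseteq> set xs"
  shows "mcoeff (qsym_delta K :: ('c xyvar, 'k::comm_ring_1) mps) m = mcoeff (list_M (alphabet_power alph_XY) xs (columns K)) m"
  unfolding qsym_delta_def
proof (rule mcoeff_qsym_M)
  fix js :: "(nat \<times> nat) list"
  assume "length js = length (columns K)"
    and "mcoeff (prod_list (map2 (alphabet_power alph_XY) js (columns K)) :: ('c xyvar, 'k) mps) m \<noteq> 0"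
  then have "xy_content (set js) (sum_list (columns K)) m"
    using columns[of K] by (intro xy_content_prod_list) auto
  then have "rows m = fst ` set js" "cols m = snd ` set js"
    by (simp_all add: xy_content_def)
  then have "set js \<subseteq> rows m \<times> cols m"
    by (simp add: subset_fst_snd)
  with assms show "set js \<subseteq> set xs"
    by blast
qed (rule assms)

lemma xy_content_qsym_delta:
  fixes K :: "'c::semigroup_add vcomp"
  assumes "mcoeff (qsym_delta K :: ('c xyvar, 'k::comm_ring_1) mps) m \<noteq> 0"
  shows "\<exists>P. xy_content P (sum_list (columns K)) m"
proof -
  let ?xs = "sorted_list_of_set (rows m \<times> cols m)"
  have "mcoeff (list_M (alphabet_power alph_XY) ?xs (columns K) :: ('c xyvar, 'k) mps) m \<noteq> 0"
    using assms mcoeff_qsym_delta[of ?xs m K, where ?'k = 'k] by simp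
  moreover have "0 \<notin> set (columns K)"
    using columns[of K] by simp
  ultimately show ?thesis
    using xy_content_list_M by blast
qed

section \<open>Quasi-symmetry\<close>

text \<open>Pushforward of an exponent vector along an injection of variables. Being written with
  \<open>inv \<phi>\<close>, it has this meaning only for injective \<open>\<phi>\<close>.\<close>

definition push :: "('v \<Rightarrow> 'w) \<Rightarrow> ('v \<Rightarrow>\<^sub>0 nat) \<Rightarrow> ('w \<Rightarrow>\<^sub>0 nat)" where
  "push \<phi> m = Abs_poly_mapping (\<lambda>w. if w \<in> range \<phi> then lookup m (inv \<phi> w) else 0)"

lemma lookup_push:
  assumes "inj \<phi>"
  shows "lookup (push \<phi> m) w = (if w \<in> range \<phi> then lookup m (inv \<phi> w) else 0)"
proof -
  have "{w. (if w \<in> range \<phi> then lookup m (inv \<phi> w) else 0) \<noteq> 0} \<subseteq> \<phi> ` keys m"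
    using assms by (auto simp: in_keys_iff)
  then have "finite {w. (if w \<in> range \<phi> then lookup m (inv \<phi> w) else 0) \<noteq> 0}"
    by (rule finite_subset) simp
  then show ?thesis
    by (simp add: push_def)
qed

lemma lookup_push_apply: "inj \<phi> \<Longrightarrow> lookup (push \<phi> m) (\<phi> v) = lookup m v"
  by (simp add: lookup_push)

lemma keys_push:
  assumes "inj \<phi>"
  shows "keys (push \<phi> m) = \<phi> ` keys m"
  using assms by (auto simp: in_keys_iff lookup_push split: if_splits)

lemma push_add: "inj \<phi> \<Longrightarrow> push \<phi> (a + b) = push \<phi> a + push \<phi> b"
  by (rule poly_mapping_eqI) (simp add: lookup_push lookup_add)

lemma push_0: "inj \<phi> \<Longrightarrow> push \<phi> 0 = 0"
  by (rule poly_mapping_eqI) (simp add: lookup_push)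

lemma push_single: "inj \<phi> \<Longrightarrow> push \<phi> (single v k) = single (\<phi> v) k"
  by (rule poly_mapping_eqI) (auto simp: lookup_push lookup_single when_def f_inv_into_f; metis rangeI)

lemma push_sum: "inj \<phi> \<Longrightarrow> push \<phi> (sum f X) = (\<Sum>x\<in>X. push \<phi> (f x))"
  by (induction X rule: infinite_finite_induct) (simp_all add: push_0 push_add)

lemma map_key_push: "inj \<phi> \<Longrightarrow> Poly_Mapping.map_key \<phi> (push \<phi> m) = m"
  by (rule poly_mapping_eqI) (simp add: map_key.rep_eq lookup_push_apply)

lemma push_eq_iff: "inj \<phi> \<Longrightarrow> push \<phi> a = push \<phi> b \<longleftrightarrow> a = b"
  by (metis map_key_push)

lemma push_eq_0_iff: "inj \<phi> \<Longrightarrow> push \<phi> m = 0 \<longleftrightarrow> m = 0"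
  using push_eq_iff[of \<phi> m 0] by (simp add: push_0)

lemma push_map_key:
  assumes "inj \<phi>" "keys m \<subseteq> range \<phi>"
  shows "push \<phi> (Poly_Mapping.map_key \<phi> m) = m"
proof (rule poly_mapping_eqI)
  fix w
  show "lookup (push \<phi> (Poly_Mapping.map_key \<phi> m)) w = lookup m w"
    using assms by (cases "w \<in> range \<phi>") (auto simp: lookup_push map_key.rep_eq in_keys_iff)
qed

lemma mdeg_push: "inj \<phi> \<Longrightarrow> mdeg (push \<phi> m) = mdeg m"
  by (auto simp: mdeg_def keys_push sum.reindex lookup_push_apply inj_on_def)

text \<open>Pulling back along an injection of the variables sets all variables outside its range to zero.\<close>

definition pull :: "('v \<Rightarrow> 'w) \<Rightarrow> ('w, 'k::comm_ring_1) mps \<Rightarrow> ('v, 'k) mps" where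
  "pull \<phi> f = Mps (\<lambda>m. mcoeff f (push \<phi> m))"

lemma mcoeff_pull: "mcoeff (pull \<phi> f) m = mcoeff f (push \<phi> m)"
  by (simp add: pull_def)

lemma pull_0: "pull \<phi> 0 = 0"
  and pull_add: "pull \<phi> (f + g) = pull \<phi> f + pull \<phi> g"
  by (rule mps_eqI, simp add: mcoeff_pull mcoeff_simps)+

lemma pull_1: "inj \<phi> \<Longrightarrow> pull \<phi> 1 = 1"
  by (rule mps_eqI) (simp add: mcoeff_pull mcoeff_simps push_eq_0_iff)

text \<open>Exponents are natural numbers, so both parts of a decomposition of
  \<open>push \<phi> m\<close> avoid the variables outside \<open>range \<phi>\<close>; such
  decompositions correspond to those of \<open>m\<close>.\<close>

lemma pull_mult:
  assumes "inj \<phi>"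
  shows "pull \<phi> (f * g) = pull \<phi> f * pull \<phi> g"
proof (rule mps_eqI)
  fix m
  have keys: "keys a \<subseteq> range \<phi>" "keys b \<subseteq> range \<phi>" if "a + b = push \<phi> m" for a b
  proof -
    have "keys (a + b) \<subseteq> range \<phi>"
      unfolding that keys_push[OF assms] by (rule image_mono) simp
    then show "keys a \<subseteq> range \<phi>" "keys b \<subseteq> range \<phi>"
      by (simp_all add: keys_add_nat)
  qed
  have "mcoeff (pull \<phi> (f * g)) m = (\<Sum>(a, b)\<in>{(a, b). a + b = push \<phi> m}. mcoeff f a * mcoeff g b)"
    by (simp add: mcoeff_pull mcoeff_simps)
  also have "\<dots> = (\<Sum>(a, b)\<in>{(a, b). a + b = m}. mcoeff f (push \<phi> a) * mcoeff g (push \<phi> b))"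
  proof (rule sum.reindex_bij_witness[where
          i = "map_prod (push \<phi>) (push \<phi>)" and
          j = "map_prod (Poly_Mapping.map_key \<phi>) (Poly_Mapping.map_key \<phi>)"])
    fix p
    assume "p \<in> {(a, b). a + b = push \<phi> m}"
    then obtain a b where p: "p = (a, b)" and ab: "a + b = push \<phi> m"
      by auto
    note push_back = push_map_key[OF assms keys(1)[OF ab]] push_map_key[OF assms keys(2)[OF ab]]
    show "map_prod (push \<phi>) (push \<phi>) (map_prod (Poly_Mapping.map_key \<phi>) (Poly_Mapping.map_key \<phi>) p) = p"
      by (simp add: p push_back)
    have "push \<phi> (Poly_Mapping.map_key \<phi> a + Poly_Mapping.map_key \<phi> b) = push \<phi> m"
      by (simp add: push_add[OF assms] push_back ab)
    then show "map_prod (Poly_Mapping.map_key \<phi>) (Poly_Mapping.map_key \<phi>) p \<in> {(a, b). a + b = m}"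
      by (simp add: p push_eq_iff[OF assms])
    show "(case map_prod (Poly_Mapping.map_key \<phi>) (Poly_Mapping.map_key \<phi>) p of
        (a, b) \<Rightarrow> mcoeff f (push \<phi> a) * mcoeff g (push \<phi> b)) = (case p of (a, b) \<Rightarrow> mcoeff f a * mcoeff g b)"
      by (simp add: p push_back)
  qed (use assms in \<open>auto simp: map_key_push push_add[OF assms, symmetric]\<close>)
  finally show "mcoeff (pull \<phi> (f * g)) m = mcoeff (pull \<phi> f * pull \<phi> g) m"
    by (simp add: mcoeff_pull mcoeff_simps)
qed

lemma pull_sum: "pull \<phi> (sum f X) = (\<Sum>x\<in>X. pull \<phi> (f x))"
  by (induction X rule: infinite_finite_induct) (simp_all add: pull_0 pull_add)

lemma pull_power: "inj \<phi> \<Longrightarrow> pull \<phi> (f ^ k) = pull \<phi> f ^ k"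
  by (induction k) (simp_all add: pull_1 pull_mult)

lemma pull_prod: "inj \<phi> \<Longrightarrow> pull \<phi> (prod f X) = (\<Prod>x\<in>X. pull \<phi> (f x))"
  by (induction X rule: infinite_finite_induct) (simp_all add: pull_1 pull_mult)

lemma pull_mvar: "inj \<phi> \<Longrightarrow> pull \<phi> (mvar (\<phi> v)) = mvar v"
  by (rule mps_eqI) (simp add: mcoeff_pull mvar_eq_monom mcoeff_monom push_single[symmetric] push_eq_iff)

lemma pull_alphabet_power:
  "inj \<phi> \<Longrightarrow> pull \<phi> (alphabet_power A j n) = alphabet_power (\<lambda>j c. pull \<phi> (A j c)) j n"
  by (simp add: alphabet_power_def pull_prod pull_power)

lemma pull_list_M:
  assumes "inj \<phi>"
  shows "pull \<phi> (list_M (alphabet_power A) xs ns) = list_M (alphabet_power (\<lambda>j c. pull \<phi> (A j c))) xs ns"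
  using assms
  by (subst list_M_hom[where h = "pull \<phi>"]) (auto simp: pull_0 pull_1 pull_add pull_mult pull_alphabet_power)

section \<open>Strictly increasing relabelings of rows and columns\<close>

definition relabel :: "(nat \<Rightarrow> nat) \<Rightarrow> (nat \<Rightarrow> nat) \<Rightarrow> 'c xyvar \<Rightarrow> 'c xyvar" where
  "relabel e e' = map_sum (map_prod e id) (map_prod e' id)"

lemma relabel_simps [simp]:
  "relabel e e' (Inl (r, c)) = Inl (e r, c)" "relabel e e' (Inr (s, c)) = Inr (e' s, c)"
  by (simp_all add: relabel_def)

lemma xyvar_cases:
  fixes x :: "'c xyvar"
  obtains r c where "x = Inl (r, c)" | s c where "x = Inr (s, c)"
  by (cases x) auto

lemma inj_relabel:
  assumes "inj e" "inj e'"
  shows "inj (relabel e e')"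
  unfolding relabel_def using assms by (intro sum.inj_map prod.inj_map inj_on_id)

lemma rows_push_relabel:
  fixes m :: "'c xyvar \<Rightarrow>\<^sub>0 nat"
  assumes "inj e" "inj e'"
  shows "rows (push (relabel e e') m) = e ` rows m"
proof -
  have "Inl (r, c) \<in> relabel e e' ` keys m \<longleftrightarrow> (\<exists>r'. r = e r' \<and> Inl (r', c) \<in> keys m)" for r c
  proof
    assume "Inl (r, c) \<in> relabel e e' ` keys m"
    then obtain y where "y \<in> keys m" "Inl (r, c) = relabel e e' y"
      by blast
    then show "\<exists>r'. r = e r' \<and> Inl (r', c) \<in> keys m"
      by (cases y rule: xyvar_cases) auto
  qed (auto intro: rev_image_eqI)
  then show ?thesis
    by (auto simp: rows_def keys_push[OF inj_relabel[OF assms]])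
qed

lemma cols_push_relabel:
  fixes m :: "'c xyvar \<Rightarrow>\<^sub>0 nat"
  assumes "inj e" "inj e'"
  shows "cols (push (relabel e e') m) = e' ` cols m"
proof -
  have "Inr (s, c) \<in> relabel e e' ` keys m \<longleftrightarrow> (\<exists>s'. s = e' s' \<and> Inr (s', c) \<in> keys m)" for s c
  proof
    assume "Inr (s, c) \<in> relabel e e' ` keys m"
    then obtain y where "y \<in> keys m" "Inr (s, c) = relabel e e' y"
      by blast
    then show "\<exists>s'. s = e' s' \<and> Inr (s', c) \<in> keys m"
      by (cases y rule: xyvar_cases) auto
  qed (auto intro: rev_image_eqI)
  then show ?thesis
    by (auto simp: cols_def keys_push[OF inj_relabel[OF assms]])
qed

lemma pull_alph_XY:
  fixes \<gamma> :: "'c::semigroup_add"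
  assumes "inj e" "inj e'"
  shows "pull (relabel e e') (alph_XY (e r, e' s) \<gamma>) = (alph_XY (r, s) \<gamma> :: ('c xyvar, 'k::comm_ring_1) mps)"
proof -
  have "pull (relabel e e') (alph_X (e r) \<alpha>) = (alph_X r \<alpha> :: ('c xyvar, 'k) mps)" for \<alpha>
    using pull_mvar[OF inj_relabel[OF assms], of "Inl (r, \<alpha>)"] by (simp add: alph_X_def)
  moreover have "pull (relabel e e') (alph_Y (e' s) \<beta>) = (alph_Y s \<beta> :: ('c xyvar, 'k) mps)" for \<beta>
    using pull_mvar[OF inj_relabel[OF assms], of "Inr (s, \<beta>)"] by (simp add: alph_Y_def)
  ultimately show ?thesis
    using assms by (simp add: alph_XY_def pull_sum pull_mult inj_relabel case_prod_unfold)
qed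

text \<open>Quasi-symmetry in both alphabets at once. Strictly increasing maps of rows and columns
  preserve the lexicographic order of pairs, so the relabeled rectangle is again listed
  increasingly, and pulling back turns its variables into the original ones.\<close>

lemma qsym_delta_relabel:
  fixes K :: "'c::semigroup_add vcomp"
  assumes "strict_mono e" "strict_mono e'"
  shows "mcoeff (qsym_delta K :: ('c xyvar, 'k::comm_ring_1) mps) (push (relabel e e') m) =
    mcoeff (qsym_delta K) m"
proof -
  let ?\<phi> = "relabel e e' :: 'c xyvar \<Rightarrow> 'c xyvar"
  let ?xs = "sorted_list_of_set (rows m \<times> cols m)"
  have inj: "inj e" "inj e'"
    using assms by (auto intro: strict_mono_imp_inj_on)
  then have inj_\<phi>: "inj ?\<phi>"
    by (rule inj_relabel)
  have "sorted_wrt (<) (map (map_prod e e') ?xs)"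
    unfolding sorted_wrt_map
  proof (rule sorted_wrt_mono_rel[OF _ strict_sorted_list_of_set])
    fix x y :: "nat \<times> nat"
    assume "x < y"
    then show "map_prod e e' x < map_prod e e' y"
      using assms
      by (cases x; cases y) (auto simp: less_prod_def strict_mono_less strict_mono_less_eq)
  qed
  moreover have "rows (push ?\<phi> m) \<times> cols (push ?\<phi> m) \<subseteq> set (map (map_prod e e') ?xs)"
    by (auto simp: rows_push_relabel[OF inj] cols_push_relabel[OF inj])
  ultimately have "mcoeff (qsym_delta K :: ('c xyvar, 'k) mps) (push ?\<phi> m) =
      mcoeff (list_M (alphabet_power alph_XY) (map (map_prod e e') ?xs) (columns K)) (push ?\<phi> m)"
    by (rule mcoeff_qsym_delta)
  also have "\<dots> = mcoeff (list_M (alphabet_power (\<lambda>j c. pull ?\<phi> (alph_XY (map_prod e e' j) c))) ?xs (columns K)) m"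
  proof -
    have "(\<lambda>j. alphabet_power alph_XY (map_prod e e' j)) =
        (alphabet_power (\<lambda>j. alph_XY (map_prod e e' j)) :: _ \<Rightarrow> _ \<Rightarrow> ('c xyvar, 'k) mps)"
      by (simp add: alphabet_power_def fun_eq_iff)
    then show ?thesis
      by (simp add: mcoeff_pull[symmetric] list_M_map pull_list_M[OF inj_\<phi>])
  qed
  also have "\<dots> = mcoeff (list_M (alphabet_power alph_XY) ?xs (columns K)) m"
    by (simp add: case_prod_unfold pull_alph_XY inj map_prod_def)
  also have "\<dots> = mcoeff (qsym_delta K) m"
    by (rule mcoeff_qsym_delta[symmetric]) auto
  finally show ?thesis .
qed

section \<open>Monomials coded by lists of vectors, and deletion of empty rows and columns\<close>

definition row_mon :: "('c \<Rightarrow>\<^sub>0 nat) list \<Rightarrow> (nat \<times> 'c \<Rightarrow>\<^sub>0 nat)" where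
  "row_mon u = Abs_poly_mapping (\<lambda>(r, c). if r < length u then lookup (u ! r) c else 0)"

lemma lookup_row_mon: "lookup (row_mon u) (r, c) = (if r < length u then lookup (u ! r) c else 0)"
proof -
  let ?f = "\<lambda>(r, c). if r < length u then lookup (u ! r) c else 0"
  have "{v. ?f v \<noteq> 0} \<subseteq> {..<length u} \<times> (\<Union>n\<in>set u. keys n)"
    by (fastforce simp: in_keys_iff split: if_splits)
  then have "finite {v. ?f v \<noteq> 0}"
    by (rule finite_subset) simp
  then show ?thesis
    by (simp add: row_mon_def)
qed

text \<open>Zero entries of \<open>u\<close> and \<open>v\<close> are allowed here: they are the empty rows and columns.\<close>

definition xy_mon :: "('c \<Rightarrow>\<^sub>0 nat) list \<Rightarrow> ('c \<Rightarrow>\<^sub>0 nat) list \<Rightarrow> ('c xyvar \<Rightarrow>\<^sub>0 nat)" where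
  "xy_mon u v = push Inl (row_mon u) + push Inr (row_mon v)"

lemma lookup_xy_mon [simp]:
  "lookup (xy_mon u v) (Inl (r, c)) = (if r < length u then lookup (u ! r) c else 0)"
  "lookup (xy_mon u v) (Inr (s, c)) = (if s < length v then lookup (v ! s) c else 0)"
  by (auto simp: xy_mon_def lookup_add lookup_push lookup_row_mon)

text \<open>Allows identities of power series to be checked at the monomials
  \<open>xy_mon u v\<close> only; the lists are taken long enough to reach all occupied rows and
  columns.\<close>

lemma xy_mon_surj: "\<exists>u v. m = xy_mon u v" for m :: "'c xyvar \<Rightarrow>\<^sub>0 nat"
proof -
  obtain p q where p: "rows m \<subseteq> {..<p}" and q: "cols m \<subseteq> {..<q}"
    using finite_rows[of m] finite_cols[of m]
    by (meson finite_nat_set_iff_bounded lessThan_iff subsetI)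
  let ?u = "map (\<lambda>r. Poly_Mapping.map_key (\<lambda>c. Inl (r, c)) m) [0..<p]"
  let ?v = "map (\<lambda>s. Poly_Mapping.map_key (\<lambda>c. Inr (s, c)) m) [0..<q]"
  have "m = xy_mon ?u ?v"
  proof (rule poly_mapping_eqI)
    fix x
    show "lookup m x = lookup (xy_mon ?u ?v) x"
      using p q
      by (cases x rule: xyvar_cases) (auto simp: map_key.rep_eq inj_def rows_def cols_def in_keys_iff)
  qed
  then show ?thesis
    by blast
qed

text \<open>The coface map: the increasing enumeration of all natural numbers except
  \<open>k\<close>.\<close>

definition skip :: "nat \<Rightarrow> nat \<Rightarrow> nat" where
  "skip k r = (if r < k then r else Suc r)"

lemma strict_mono_skip: "strict_mono (skip k)"
  by (rule strict_monoI) (simp add: skip_def)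

lemma range_skip: "range (skip k) = - {k}"
proof
  show "- {k} \<subseteq> range (skip k)"
  proof
    fix r
    assume "r \<in> - {k}"
    then have "r = skip k (if r < k then r else r - 1)"
      by (auto simp: skip_def)
    then show "r \<in> range (skip k)"
      by blast
  qed
qed (auto simp: skip_def)

text \<open>The variables missed by the relabeling are those of row \<open>length w\<close>, where
  the exponents are zero. So inserting an empty row is an instance of quasi-symmetry.\<close>

lemma xy_mon_skip_row: "xy_mon (w @ 0 # u) v = push (relabel (skip (length w)) id) (xy_mon (w @ u) v)"
  (is "_ = push ?\<phi> _")
proof (rule poly_mapping_eqI)
  fix x
  have inj: "inj ?\<phi>"
    by (intro inj_relabel strict_mono_imp_inj_on[OF strict_mono_skip]) simp
  show "lookup (xy_mon (w @ 0 # u) v) x = lookup (push ?\<phi> (xy_mon (w @ u) v)) x"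
  proof (cases "x \<in> range ?\<phi>")
    case True
    then obtain y where y: "x = ?\<phi> y"
      by blast
    show ?thesis
      unfolding y lookup_push_apply[OF inj]
      by (cases y rule: xyvar_cases) (auto simp: skip_def nth_append nth_Cons')
  next
    case False
    moreover have "Inl (skip (length w) r, c) \<in> range ?\<phi>" for r and c :: 'a
      by (rule range_eqI[of _ _ "Inl (r, c)"]) simp
    moreover have "Inr (s, c) \<in> range ?\<phi>" for s and c :: 'a
      by (rule range_eqI[of _ _ "Inr (s, c)"]) simp
    ultimately have "\<exists>c. x = Inl (length w, c)"
      using range_skip[of "length w"] by (cases x rule: xyvar_cases) (auto, metis ComplI imageE singletonD)
    with False show ?thesis
      by (auto simp: lookup_push[OF inj])
  qed
qed

lemma xy_mon_skip_col: "xy_mon u (w @ 0 # v) = push (relabel id (skip (length w))) (xy_mon u (w @ v))"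
  (is "_ = push ?\<phi> _")
proof (rule poly_mapping_eqI)
  fix x
  have inj: "inj ?\<phi>"
    by (intro inj_relabel strict_mono_imp_inj_on[OF strict_mono_skip]) simp
  show "lookup (xy_mon u (w @ 0 # v)) x = lookup (push ?\<phi> (xy_mon u (w @ v))) x"
  proof (cases "x \<in> range ?\<phi>")
    case True
    then obtain y where y: "x = ?\<phi> y"
      by blast
    show ?thesis
      unfolding y lookup_push_apply[OF inj]
      by (cases y rule: xyvar_cases) (auto simp: skip_def nth_append nth_Cons')
  next
    case False
    moreover have "Inr (skip (length w) s, c) \<in> range ?\<phi>" for s and c :: 'a
      by (rule range_eqI[of _ _ "Inr (s, c)"]) simp
    moreover have "Inl (r, c) \<in> range ?\<phi>" for r and c :: 'a
      by (rule range_eqI[of _ _ "Inl (r, c)"]) simp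
    ultimately have "\<exists>c. x = Inr (length w, c)"
      using range_skip[of "length w"] by (cases x rule: xyvar_cases) (auto, metis ComplI imageE singletonD)
    with False show ?thesis
      by (auto simp: lookup_push[OF inj])
  qed
qed

lemma qsym_delta_filter:
  fixes K :: "'c::semigroup_add vcomp"
  shows "mcoeff (qsym_delta K :: ('c xyvar, 'k::comm_ring_1) mps)
      (xy_mon (filter (\<lambda>n. n \<noteq> 0) u) (filter (\<lambda>n. n \<noteq> 0) v)) = mcoeff (qsym_delta K) (xy_mon u v)"
proof -
  have id: "strict_mono (id :: nat \<Rightarrow> nat)"
    by (simp add: strict_mono_def)
  \<comment> \<open>The prefix \<open>w\<close> collects the entries already passed, so that a zero
    is removed at its actual position.\<close>
  have row: "mcoeff (qsym_delta K :: ('c xyvar, 'k) mps) (xy_mon (w @ filter (\<lambda>n. n \<noteq> 0) u) v) =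
      mcoeff (qsym_delta K) (xy_mon (w @ u) v)" for w u v
  proof (induction u arbitrary: w)
    case (Cons n u)
    show ?case
      using Cons.IH[of w] Cons.IH[of "w @ [n]"]
      by (auto simp: xy_mon_skip_row qsym_delta_relabel strict_mono_skip id)
  qed simp
  have col: "mcoeff (qsym_delta K :: ('c xyvar, 'k) mps) (xy_mon u (w @ filter (\<lambda>n. n \<noteq> 0) v)) =
      mcoeff (qsym_delta K) (xy_mon u (w @ v))" for w u v
  proof (induction v arbitrary: w)
    case (Cons n v)
    show ?case
      using Cons.IH[of w] Cons.IH[of "w @ [n]"]
      by (auto simp: xy_mon_skip_col qsym_delta_relabel strict_mono_skip id)
  qed simp
  show ?thesis
    using row[of "[]" u] col[of _ "[]" v] by simp
qed

section \<open>Monomial quasi-symmetric functions\<close>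

text \<open>The index of the product of the S_n over \<open>u\<close> when zero vectors are allowed,
  in accordance with S_0 = 1.\<close>

definition compress :: "('c \<Rightarrow>\<^sub>0 nat) list \<Rightarrow> 'c vcomp" where
  "compress u = Vcomp (filter (\<lambda>n. n \<noteq> 0) u)"

lemma zero_notin_columns [simp]: "0 \<notin> set (columns I)"
  using columns[of I] by simp

lemma columns_compress: "columns (compress u) = filter (\<lambda>n. n \<noteq> 0) u"
  by (simp add: compress_def Vcomp_inverse)

lemma compress_columns [simp]: "compress (columns I) = I"
proof -
  have "filter (\<lambda>n. n \<noteq> 0) (columns I) = columns I"
    by (rule filter_True) (metis zero_notin_columns)
  then show ?thesis
    by (simp add: compress_def columns_inverse)
qed

lemma compress_eq_iff: "compress u = I \<longleftrightarrow> filter (\<lambda>n. n \<noteq> 0) u = columns I"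
  by (metis columns_compress columns_inject)

lemma monom_single_power: "monom (single v 1) ^ k = monom (single v k)"
  by (induction k) (simp_all add: monom_0 monom_mult flip: single_add)

lemma monom_prod: "(\<Prod>x\<in>X. monom (f x)) = monom (\<Sum>x\<in>X. f x)"
  by (induction X rule: infinite_finite_induct) (simp_all add: monom_0 monom_mult)

lemma inj_Pair_comp: "inj \<iota> \<Longrightarrow> inj (\<lambda>c. \<iota> (r, c))"
  by (auto simp: inj_def)

text \<open>The embedding \<open>\<iota>\<close> is kept general so that the same facts serve X
  through \<open>Inl\<close>, Y through \<open>Inr\<close>, and a plain alphabet through the
  identity.\<close>

lemma alphabet_power_mvar:
  assumes "inj \<iota>"
  shows "alphabet_power (\<lambda>r c. mvar (\<iota> (r, c))) r n =
    (monom (push (\<lambda>c. \<iota> (r, c)) n) :: ('v, 'k::comm_ring_1) mps)"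
proof -
  have "alphabet_power (\<lambda>r c. mvar (\<iota> (r, c))) r n =
      (monom (\<Sum>c\<in>keys n. push (\<lambda>c. \<iota> (r, c)) (single c (lookup n c))) :: ('v, 'k) mps)"
    unfolding alphabet_power_def mvar_eq_monom monom_single_power monom_prod
    by (simp add: push_single[OF inj_Pair_comp[OF assms]])
  also have "\<dots> = monom (push (\<lambda>c. \<iota> (r, c)) n)"
    by (simp add: push_sum[OF inj_Pair_comp[OF assms], symmetric] poly_mapping_sum_single)
  finally show ?thesis .
qed

text \<open>Since no vector in \<open>ns\<close> is zero, every chosen position leaves a variable in
  the monomial; this bounds the contributing positions.\<close>

lemma mvar_prod_list_keys:
  assumes "inj \<iota>" "length js = length ns" "0 \<notin> set ns"
    and "mcoeff (prod_list (map2 (alphabet_power (\<lambda>r c. mvar (\<iota> (r, c)))) js ns)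
      :: ('v, 'k::comm_ring_1) mps) m \<noteq> 0"
  shows "keys m \<subseteq> range \<iota> \<and> (\<forall>r\<in>set js. \<exists>c. \<iota> (r, c) \<in> keys m)"
  using assms(2-)
proof (induction js ns arbitrary: m rule: list_induct2)
  case Nil
  then show ?case
    by (auto simp: mcoeff_simps split: if_splits)
next
  case (Cons r js n ns)
  from Cons.prems(2) have "mcoeff (monom (push (\<lambda>c. \<iota> (r, c)) n) *
      prod_list (map2 (alphabet_power (\<lambda>r c. mvar (\<iota> (r, c)))) js ns) :: ('v, 'k) mps) m \<noteq> 0"
    by (simp add: alphabet_power_mvar[OF assms(1)])
  then obtain b where m: "m = push (\<lambda>c. \<iota> (r, c)) n + b" and
    b: "mcoeff (prod_list (map2 (alphabet_power (\<lambda>r c. mvar (\<iota> (r, c)))) js ns) :: ('v, 'k) mps) b \<noteq> 0"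
    by (rule mcoeff_monom_mult_nonzeroE) blast
  obtain c where "c \<in> keys n"
    using Cons.prems(1) by (metis ex_in_conv keys_eq_empty list.set_intros(1))
  then show ?case
    using Cons.IH[OF _ b] Cons.prems(1)
    by (auto intro: exI[of _ c] simp: m keys_add_nat keys_push[OF inj_Pair_comp[OF assms(1)]])
qed

lemma mcoeff_qsym_M_mvar:
  assumes "inj \<iota>" "sorted_wrt (<) xs" "{r. \<exists>c. \<iota> (r, c) \<in> keys m} \<subseteq> set xs"
  shows "mcoeff (qsym_M I (\<lambda>r c. mvar (\<iota> (r, c))) :: ('v, 'k::comm_ring_1) mps) m =
    mcoeff (list_M (alphabet_power (\<lambda>r c. mvar (\<iota> (r, c)))) xs (columns I)) m"
proof (rule mcoeff_qsym_M)
  fix js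
  assume "length js = length (columns I)" "mcoeff (prod_list
    (map2 (alphabet_power (\<lambda>r c. mvar (\<iota> (r, c)))) js (columns I)) :: ('v, 'k) mps) m \<noteq> 0"
  from mvar_prod_list_keys[OF assms(1) this(1) zero_notin_columns this(2)] assms(3)
  show "set js \<subseteq> set xs"
    by blast
qed (rule assms)

lemma keys_qsym_M_mvar:
  assumes "inj \<iota>" "mcoeff (qsym_M I (\<lambda>r c. mvar (\<iota> (r, c))) :: ('v, 'k::comm_ring_1) mps) m \<noteq> 0"
  shows "keys m \<subseteq> range \<iota>"
proof (rule ccontr)
  assume "\<not> keys m \<subseteq> range \<iota>"
  then have "mcoeff (prod_list
    (map2 (alphabet_power (\<lambda>r c. mvar (\<iota> (r, c)))) js (columns I)) :: ('v, 'k) mps) m = 0"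
    if "length js = length (columns I)" for js
    using mvar_prod_list_keys[OF assms(1) that zero_notin_columns] by blast
  then have "mcoeff (qsym_M I (\<lambda>r c. mvar (\<iota> (r, c))) :: ('v, 'k) mps) m = 0"
    unfolding qsym_M_def mcoeff_Mps by (auto simp: Sum_any.expand_set intro!: sum.neutral)
  with assms(2) show False
    by simp
qed

lemma lookup_push_Pair: "lookup (push (Pair k) n) (r, c) = (if r = k then lookup n c else 0)"
  using lookup_push_apply[of "Pair k" n c] by (auto simp: lookup_push inj_def)

lemma list_M_mvar_support:
  assumes "mcoeff (list_M (alphabet_power (\<lambda>r c. mvar (r, c))) xs ns
      :: (nat \<times> 'c, 'k::comm_ring_1) mps) m \<noteq> 0" "lookup m (r, c) \<noteq> 0"
  shows "r \<in> set xs"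
  using assms
proof (induction xs arbitrary: ns m)
  case Nil
  then show ?case
    by (auto simp: mcoeff_simps split: if_splits)
next
  case (Cons x xs)
  show ?case
  proof (cases ns)
    case Nil
    with Cons.prems show ?thesis
      by (auto simp: mcoeff_simps split: if_splits)
  next
    case ns: (Cons n ns')
    show ?thesis
    proof (cases "mcoeff (list_M (alphabet_power (\<lambda>r c. mvar (r, c))) xs ns :: (nat \<times> 'c, 'k) mps) m = 0")
      case True
      with Cons.prems ns have "mcoeff (monom (push (Pair x) n) *
          list_M (alphabet_power (\<lambda>r c. mvar (r, c))) xs ns' :: (nat \<times> 'c, 'k) mps) m \<noteq> 0"
        using alphabet_power_mvar[of "\<lambda>v :: nat \<times> 'c. v" x n, where ?'k = 'k] by (simp add: mcoeff_simps(3))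
      then obtain b where m: "m = push (Pair x) n + b" and
        b: "mcoeff (list_M (alphabet_power (\<lambda>r c. mvar (r, c))) xs ns' :: (nat \<times> 'c, 'k) mps) b \<noteq> 0"
        by (rule mcoeff_monom_mult_nonzeroE) blast
      show ?thesis
      proof (cases "r = x")
        case False
        with m Cons.prems(2) have "lookup b (r, c) \<noteq> 0"
          by (simp add: lookup_add lookup_push_Pair)
        from Cons.IH[OF b this] show ?thesis
          by simp
      qed simp
    next
      case False
      from Cons.IH[OF this Cons.prems(2)] show ?thesis
        by simp
    qed
  qed
qed

lemma row_mon_eq_0_iff: "row_mon u = 0 \<longleftrightarrow> (\<forall>n\<in>set u. n = 0)"
proof
  assume *: "row_mon u = 0"
  show "\<forall>n\<in>set u. n = 0"
  proof
    fix n
    assume "n \<in> set u"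
    then obtain r where r: "r < length u" "n = u ! r"
      by (auto simp: in_set_conv_nth)
    have "lookup n c = 0" for c
      using r lookup_row_mon[of u r c] * by simp
    then show "n = 0"
      by (intro poly_mapping_eqI) simp
  qed
next
  assume *: "\<forall>n\<in>set u. n = 0"
  show "row_mon u = 0"
  proof (rule poly_mapping_eqI)
    fix x
    show "lookup (row_mon u) x = lookup 0 x"
      using * nth_mem by (cases x) (fastforce simp: lookup_row_mon)
  qed
qed

text \<open>The alphabet starts at \<open>k\<close> and \<open>u\<close> is preceded by
  \<open>k\<close> zero rows, so that the induction can drop the first row of \<open>u\<close>
  without renumbering the others.\<close>

lemma mcoeff_list_M_mvar_row_mon:
  assumes "0 \<notin> set ns"
  shows "mcoeff (list_M (alphabet_power (\<lambda>r c. mvar (r, c))) [k..<k + length u] ns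
      :: (nat \<times> 'c, 'k::comm_ring_1) mps) (row_mon (replicate k 0 @ u)) =
    (if filter (\<lambda>n. n \<noteq> 0) u = ns then 1 else 0)"
  using assms
proof (induction u arbitrary: k ns)
  case Nil
  have "row_mon (replicate k 0) = (0 :: nat \<times> 'c \<Rightarrow>\<^sub>0 nat)"
    by (simp add: row_mon_eq_0_iff)
  then show ?case
    by (simp add: mcoeff_simps)
next
  case (Cons n u)
  let ?f = "alphabet_power (\<lambda>r c. mvar (r, c)) :: nat \<Rightarrow> ('c \<Rightarrow>\<^sub>0 nat) \<Rightarrow> (nat \<times> 'c, 'k) mps"
  let ?xs = "[Suc k..<Suc k + length u]"
  let ?R = "row_mon (replicate (Suc k) 0 @ u)"
  have xs: "[k..<k + length (n # u)] = k # ?xs"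
    by (simp add: upt_rec)
  have f: "?f r n' = monom (push (Pair r) n')" for r n'
    using alphabet_power_mvar[of "\<lambda>v :: nat \<times> 'c. v"] by simp
  have R: "lookup ?R (k, c) = 0" for c
    by (simp add: lookup_row_mon nth_append del: replicate_Suc)
  have push: "lookup (push (Pair k) n') (k, c) = lookup n' c" for n' and c :: 'c
    by (simp add: lookup_push_Pair)
  have mon: "row_mon (replicate k 0 @ n # u) = push (Pair k) n + ?R" (is "?L = _")
  proof (rule poly_mapping_eqI)
    fix x :: "nat \<times> 'c"
    obtain r c where x: "x = (r, c)"
      by (cases x)
    show "lookup ?L x = lookup (push (Pair k) n + ?R) x"
    proof (cases "r = k")
      case True
      then show ?thesis
        by (simp add: x lookup_add push R del: replicate_Suc) (simp add: lookup_row_mon nth_append)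
    next
      case False
      then show ?thesis
        by (auto simp: x lookup_add lookup_push_Pair lookup_row_mon nth_append nth_Cons' simp del: replicate_Suc)
    qed
  qed
  \<comment> \<open>The remaining alphabet starts at \<open>Suc k\<close>, so the variables of row
    \<open>k\<close> can come only from the letter at position \<open>k\<close>.\<close>
  have supp: "lookup m (k, c) = 0" if "mcoeff (list_M ?f ?xs ns') m \<noteq> 0" for m c and ns' :: "('c \<Rightarrow>\<^sub>0 nat) list"
    using list_M_mvar_support[OF that, of k c] by (auto simp del: upt_Suc)
  show ?case
  proof (cases ns)
    case Nil
    have "row_mon (replicate k 0 @ n # u) = 0 \<longleftrightarrow> filter (\<lambda>n. n \<noteq> 0) (n # u) = []"
      unfolding row_mon_eq_0_iff by (auto simp: filter_empty_conv)
    with Nil show ?thesis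
      by (simp add: mcoeff_simps)
  next
    case ns: (Cons n' ns')
    \<comment> \<open>Position \<open>k\<close> is skipped, which forces row \<open>k\<close> to be
      empty.\<close>
    have first: "mcoeff (list_M ?f ?xs ns) (push (Pair k) n + ?R) =
        (if n = 0 \<and> filter (\<lambda>n. n \<noteq> 0) u = ns then 1 else 0)"
    proof (cases "n = 0")
      case True
      then show ?thesis
        using Cons.IH[OF Cons.prems, of "Suc k"] by (simp add: push_0 inj_def del: replicate_Suc)
    next
      case False
      then obtain c where "lookup n c \<noteq> 0"
        by (metis lookup_zero poly_mapping_eqI)
      then have "lookup (push (Pair k) n + ?R) (k, c) \<noteq> 0"
        by (simp add: lookup_add push del: replicate_Suc)
      with supp False show ?thesis
        by metis
    qed
    \<comment> \<open>Position \<open>k\<close> takes \<open>n'\<close>; nothing else touches row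
      \<open>k\<close>, so its content \<open>n\<close> must equal \<open>n'\<close>.\<close>
    have second: "mcoeff (monom (push (Pair k) n') * list_M ?f ?xs ns') (push (Pair k) n + ?R) =
        (if n = n' \<and> filter (\<lambda>n. n \<noteq> 0) u = ns' then 1 else 0)"
    proof (cases "n = n'")
      case True
      then show ?thesis
        using Cons.IH[of ns' "Suc k"] Cons.prems ns
        by (simp add: mcoeff_monom_mult del: replicate_Suc)
    next
      case False
      have "mcoeff (monom (push (Pair k) n') * list_M ?f ?xs ns') (push (Pair k) n + ?R) = 0"
      proof (rule ccontr)
        assume "mcoeff (monom (push (Pair k) n') * list_M ?f ?xs ns') (push (Pair k) n + ?R) \<noteq> 0"
        then obtain b where b: "push (Pair k) n + ?R = push (Pair k) n' + b" "mcoeff (list_M ?f ?xs ns') b \<noteq> 0"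
          by (rule mcoeff_monom_mult_nonzeroE) blast
        have "lookup n c = lookup n' c" for c
          using arg_cong[OF b(1), of "\<lambda>m. lookup m (k, c)"] supp[OF b(2)]
          by (simp add: lookup_add push R del: replicate_Suc)
        with False show False
          by (auto intro: poly_mapping_eqI)
      qed
      with False show ?thesis
        by simp
    qed
    \<comment> \<open>This makes the two cases exclude each other, so that the two contributions
      never add up to 2.\<close>
    have "n' \<noteq> 0"
      using Cons.prems ns by auto
    have "mcoeff (list_M ?f [k..<k + length (n # u)] ns) (row_mon (replicate k 0 @ n # u)) =
        mcoeff (list_M ?f ?xs ns) (push (Pair k) n + ?R) +
        mcoeff (monom (push (Pair k) n') * list_M ?f ?xs ns') (push (Pair k) n + ?R)"
      unfolding xs mon by (simp add: ns f mcoeff_simps(3) del: replicate_Suc upt_Suc)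
    then show ?thesis
      unfolding first second using \<open>n' \<noteq> 0\<close> ns by auto
  qed
qed

lemma mcoeff_qsym_M_mvar_row_mon:
  fixes I :: "'c vcomp"
  assumes "inj \<iota>"
  shows "mcoeff (qsym_M I (\<lambda>r c. mvar (\<iota> (r, c))) :: ('v, 'k::comm_ring_1) mps) (push \<iota> (row_mon u)) =
    (if compress u = I then 1 else 0)"
proof -
  have "{r. \<exists>c. \<iota> (r, c) \<in> keys (push \<iota> (row_mon u))} \<subseteq> set [0..<length u]"
    using assms by (auto simp: in_keys_iff lookup_push_apply lookup_row_mon split: if_splits)
  then have "mcoeff (qsym_M I (\<lambda>r c. mvar (\<iota> (r, c))) :: ('v, 'k) mps) (push \<iota> (row_mon u)) =
      mcoeff (pull \<iota> (list_M (alphabet_power (\<lambda>r c. mvar (\<iota> (r, c)))) [0..<length u] (columns I))) (row_mon u)"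
    by (simp add: mcoeff_qsym_M_mvar[OF assms, of "[0..<length u]"] mcoeff_pull)
  also have "\<dots> = (if compress u = I then 1 else 0)"
    using mcoeff_list_M_mvar_row_mon[of "columns I" 0 u, where ?'k = 'k]
    by (simp add: pull_list_M[OF assms] pull_mvar[OF assms] compress_eq_iff)
  finally show ?thesis .
qed

text \<open>The two factors involve disjoint sets of variables, so only the decomposition into x
  part and y part contributes to the product.\<close>

lemma mcoeff_qsym_MM:
  fixes I J :: "'c vcomp"
  shows "mcoeff (qsym_MM I J :: ('c xyvar, 'k::comm_ring_1) mps) (xy_mon u v) =
    (if compress u = I \<and> compress v = J then 1 else 0)"
proof -
  let ?a = "push Inl (row_mon u) :: 'c xyvar \<Rightarrow>\<^sub>0 nat" and ?b = "push Inr (row_mon v) :: 'c xyvar \<Rightarrow>\<^sub>0 nat"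
  let ?X = "qsym_M I alph_X :: ('c xyvar, 'k) mps" and ?Y = "qsym_M J alph_Y :: ('c xyvar, 'k) mps"
  have X: "alph_X = (\<lambda>r c. mvar (Inl (r, c)) :: ('c xyvar, 'k) mps)"
    and Y: "alph_Y = (\<lambda>r c. mvar (Inr (r, c)) :: ('c xyvar, 'k) mps)"
    by (simp_all add: alph_X_def alph_Y_def fun_eq_iff)
  have unique: "(a, b) = (?a, ?b)"
    if "a + b = xy_mon u v" "mcoeff ?X a * mcoeff ?Y b \<noteq> 0" for a b
  proof -
    from that(2) have "mcoeff ?X a \<noteq> 0" "mcoeff ?Y b \<noteq> 0"
      by auto
    then have keys: "keys a \<subseteq> range Inl" "keys b \<subseteq> range Inr"
      unfolding X Y by (auto dest!: keys_qsym_M_mvar[rotated])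
    have "lookup a x = lookup ?a x \<and> lookup b x = lookup ?b x" for x
    proof (cases x)
      case (Inl y)
      then have "lookup b x = 0"
        using keys(2) by (auto simp: in_keys_iff)
      moreover have "lookup ?b x = 0"
        by (simp add: Inl lookup_push image_iff)
      ultimately show ?thesis
        using arg_cong[OF that(1), of "\<lambda>m. lookup m x"] by (simp add: lookup_add xy_mon_def)
    next
      case (Inr y)
      then have "lookup a x = 0"
        using keys(1) by (auto simp: in_keys_iff)
      moreover have "lookup ?a x = 0"
        by (simp add: Inr lookup_push image_iff)
      ultimately show ?thesis
        using arg_cong[OF that(1), of "\<lambda>m. lookup m x"] by (simp add: lookup_add xy_mon_def)
    qed
    then show ?thesis
      by (auto intro: poly_mapping_eqI)
  qed
  have "mcoeff (qsym_MM I J :: ('c xyvar, 'k) mps) (xy_mon u v) =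
      (\<Sum>(a, b)\<in>{(?a, ?b)}. mcoeff ?X a * mcoeff ?Y b)"
    unfolding qsym_MM_def mcoeff_simps
    by (rule sum.mono_neutral_right) (use unique in \<open>auto simp: finite_decompositions xy_mon_def\<close>)
  also have "\<dots> = (if compress u = I \<and> compress v = J then 1 else 0)"
    by (simp add: X Y mcoeff_qsym_M_mvar_row_mon)
  finally show ?thesis .
qed

section \<open>Structure constants of the internal product\<close>

lemma keys_sum_list: "keys (sum_list ns :: 'c \<Rightarrow>\<^sub>0 nat) = (\<Union>n\<in>set ns. keys n)"
  by (induction ns) (simp_all add: keys_add_nat)

lemma mdeg_le_mdeg_sum_list: "n \<in> set ns \<Longrightarrow> mdeg n \<le> mdeg (sum_list ns)"
  by (induction ns) (auto simp: mdeg_add)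

lemma length_le_mdeg_sum_list: "0 \<notin> set ns \<Longrightarrow> length ns \<le> mdeg (sum_list ns)"
proof (induction ns)
  case (Cons n ns)
  then have "mdeg n \<noteq> 0"
    by auto
  moreover have "length ns \<le> mdeg (sum_list ns)"
    using Cons by simp
  ultimately show ?case
    unfolding list.size sum_list.Cons mdeg_add by linarith
qed simp

lemma finite_vectors:
  assumes "finite C"
  shows "finite {n :: 'c \<Rightarrow>\<^sub>0 nat. mdeg n \<le> d \<and> keys n \<subseteq> C}"
proof (rule finite_imageD)
  let ?F = "{f. \<forall>c. (c \<in> C \<longrightarrow> f c \<in> {..d}) \<and> (c \<notin> C \<longrightarrow> f c = (0 :: nat))}"
  have "finite ?F"
    using assms by (intro finite_set_of_finite_funs) auto
  moreover have "lookup ` {n. mdeg n \<le> d \<and> keys n \<subseteq> C} \<subseteq> ?F"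
    using order_trans[OF lookup_le_mdeg] by (auto simp: in_keys_iff)
  ultimately show "finite (lookup ` {n. mdeg n \<le> d \<and> keys n \<subseteq> C})"
    by (rule rev_finite_subset)
qed (auto simp: inj_on_def lookup_inject)

text \<open>Columns are nonzero, so a bound on the degree also bounds their number.\<close>

lemma finite_vcomps:
  assumes "finite C"
  shows "finite {K :: 'c vcomp. mdeg (sum_list (columns K)) \<le> d \<and> keys (sum_list (columns K)) \<subseteq> C}"
    (is "finite ?V")
proof (rule finite_imageD)
  let ?N = "{n :: 'c \<Rightarrow>\<^sub>0 nat. mdeg n \<le> d \<and> keys n \<subseteq> C}"
  have "finite {ns. set ns \<subseteq> ?N \<and> length ns \<le> d}"
    by (intro finite_lists_length_le finite_vectors assms)
  moreover have "columns ` ?V \<subseteq> {ns. set ns \<subseteq> ?N \<and> length ns \<le> d}"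
  proof (rule image_subsetI)
    fix K :: "'c vcomp"
    assume K: "K \<in> ?V"
    then have "length (columns K) \<le> d"
      using length_le_mdeg_sum_list[OF zero_notin_columns, of K] by simp
    moreover have "n \<in> ?N" if "n \<in> set (columns K)" for n
      using K that mdeg_le_mdeg_sum_list[OF that] by (auto simp: keys_sum_list)
    ultimately show "columns K \<in> {ns. set ns \<subseteq> ?N \<and> length ns \<le> d}"
      by blast
  qed
  ultimately show "finite (columns ` ?V)"
    by (rule rev_finite_subset)
qed (auto simp: inj_on_def columns_inject)

lemma row_mon_snoc: "row_mon (u @ [n]) = row_mon u + push (Pair (length u)) n"
proof (rule poly_mapping_eqI)
  fix x
  show "lookup (row_mon (u @ [n])) x = lookup (row_mon u + push (Pair (length u)) n) x"
    by (cases x) (auto simp: lookup_add lookup_push_Pair lookup_row_mon nth_append less_Suc_eq)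
qed

lemma mdeg_row_mon: "mdeg (row_mon u) = mdeg (sum_list u)"
proof (induction u rule: rev_induct)
  case Nil
  have "row_mon [] = (0 :: nat \<times> 'a \<Rightarrow>\<^sub>0 nat)"
    by (simp add: row_mon_eq_0_iff)
  then show ?case
    by simp
next
  case (snoc n u)
  then show ?case
    by (simp add: row_mon_snoc mdeg_add mdeg_push inj_def)
qed

lemma mdeg_xy_mon: "mdeg (xy_mon u v) = mdeg (sum_list u) + mdeg (sum_list v)"
  by (simp add: xy_mon_def mdeg_add mdeg_push mdeg_row_mon)

lemma keys_sum_list_nth: "c \<in> keys (sum_list u :: 'c \<Rightarrow>\<^sub>0 nat) \<longleftrightarrow> (\<exists>r<length u. lookup (u ! r) c \<noteq> 0)"
  unfolding keys_sum_list UN_iff in_keys_iff by (metis in_set_conv_nth)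

lemma Inl_keys_xy_mon: "(\<exists>r. Inl (r, c) \<in> keys (xy_mon u v)) \<longleftrightarrow> c \<in> keys (sum_list u)"
  unfolding keys_sum_list_nth by (rule ex_cong1) (simp add: in_keys_iff)

lemma Inr_keys_xy_mon: "(\<exists>s. Inr (s, c) \<in> keys (xy_mon u v)) \<longleftrightarrow> c \<in> keys (sum_list v)"
  unfolding keys_sum_list_nth by (rule ex_cong1) (simp add: in_keys_iff)

text \<open>The candidate structure constant, read off at the packed monomial;
  \<open>delta_coeff_eq\<close> identifies it with \<open>delta_coeff\<close>.\<close>

definition delta_number :: "'c::semigroup_add vcomp \<Rightarrow> 'c vcomp \<Rightarrow> 'c vcomp \<Rightarrow> 'k::comm_ring_1" where
  "delta_number K I J = mcoeff (qsym_delta K) (xy_mon (columns I) (columns J))"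

lemma qsym_delta_xy_mon:
  "mcoeff (qsym_delta K) (xy_mon u v) = delta_number K (compress u) (compress v)"
  by (simp add: delta_number_def columns_compress qsym_delta_filter)

text \<open>All four come from \<open>xy_content\<close>. The first two confine \<open>K\<close> for
  given \<open>I\<close> and \<open>J\<close>; the first and the last two confine \<open>I\<close>
  and \<open>J\<close> for given \<open>K\<close>.\<close>

lemma delta_number_nonzero:
  fixes K I J :: "'c::semigroup_add vcomp"
  assumes "(delta_number K I J :: 'k::comm_ring_1) \<noteq> 0"
  shows "mdeg (sum_list (columns I)) + mdeg (sum_list (columns J)) = 2 * mdeg (sum_list (columns K))"
    and "\<gamma> \<in> keys (sum_list (columns K)) \<Longrightarrow>
      \<exists>\<alpha>\<in>keys (sum_list (columns I)). \<exists>\<beta>\<in>keys (sum_list (columns J)). \<gamma> = \<alpha> + \<beta>"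
    and "\<alpha> \<in> keys (sum_list (columns I)) \<Longrightarrow> \<exists>\<beta>. \<alpha> + \<beta> \<in> keys (sum_list (columns K))"
    and "\<beta> \<in> keys (sum_list (columns J)) \<Longrightarrow> \<exists>\<alpha>. \<alpha> + \<beta> \<in> keys (sum_list (columns K))"
proof -
  let ?m = "xy_mon (columns I) (columns J)"
  obtain P where P: "xy_content P (sum_list (columns K)) ?m"
    using xy_content_qsym_delta assms unfolding delta_number_def by blast
  show "mdeg (sum_list (columns I)) + mdeg (sum_list (columns J)) = 2 * mdeg (sum_list (columns K))"
    using P by (simp add: xy_content_def mdeg_xy_mon)
  show "\<exists>\<alpha>\<in>keys (sum_list (columns I)). \<exists>\<beta>\<in>keys (sum_list (columns J)). \<gamma> = \<alpha> + \<beta>"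
    if "\<gamma> \<in> keys (sum_list (columns K))"
    using P that Inl_keys_xy_mon Inr_keys_xy_mon unfolding xy_content_def by metis
  show "\<exists>\<beta>. \<alpha> + \<beta> \<in> keys (sum_list (columns K))" if "\<alpha> \<in> keys (sum_list (columns I))"
    using P that Inl_keys_xy_mon[of \<alpha> "columns I" "columns J"] unfolding xy_content_def by blast
  show "\<exists>\<alpha>. \<alpha> + \<beta> \<in> keys (sum_list (columns K))" if "\<beta> \<in> keys (sum_list (columns J))"
    using P that Inr_keys_xy_mon[of \<beta> "columns I" "columns J"] unfolding xy_content_def by blast
qed

text \<open>Makes \<open>Abs_poly_mapping\<close> in \<open>internal_basis\<close> meaningful: the
  colors of \<open>K\<close> are sums of colors of \<open>I\<close> and \<open>J\<close>, and its
  degree is bounded.\<close>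

lemma finite_delta_number_left:
  fixes I J :: "'c::semigroup_add vcomp"
  shows "finite {K. (delta_number K I J :: 'k::comm_ring_1) \<noteq> 0}"
proof (rule finite_subset)
  let ?C = "(\<lambda>(\<alpha>, \<beta>). \<alpha> + \<beta>) ` (keys (sum_list (columns I)) \<times> keys (sum_list (columns J)))"
  let ?d = "mdeg (sum_list (columns I)) + mdeg (sum_list (columns J))"
  show "{K. (delta_number K I J :: 'k) \<noteq> 0} \<subseteq>
      {K. mdeg (sum_list (columns K)) \<le> ?d \<and> keys (sum_list (columns K)) \<subseteq> ?C}"
  proof (rule subsetI, unfold mem_Collect_eq, intro conjI subsetI)
    fix K
    assume K: "(delta_number K I J :: 'k) \<noteq> 0"
    show "mdeg (sum_list (columns K)) \<le> ?d"
      using delta_number_nonzero(1)[OF K] by simp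
    show "\<gamma> \<in> ?C" if "\<gamma> \<in> keys (sum_list (columns K))" for \<gamma>
      using delta_number_nonzero(2)[OF K that] by auto
  qed
  show "finite {K. mdeg (sum_list (columns K)) \<le> ?d \<and> keys (sum_list (columns K)) \<subseteq> ?C}"
    by (rule finite_vcomps) simp
qed

text \<open>The colors of \<open>I\<close> and \<open>J\<close> are only known to be summands of
  colors of \<open>K\<close>; finiteness of the color decompositions bounds them.\<close>

lemma finite_delta_number_right:
  fixes K :: "'c::semigroup_add vcomp"
  assumes finite_decomp: "\<And>\<gamma> :: 'c. finite {(\<alpha>, \<beta>). \<alpha> + \<beta> = \<gamma>}"
  shows "finite {(I, J). (delta_number K I J :: 'k::comm_ring_1) \<noteq> 0}"
proof (rule finite_subset)
  let ?D = "\<Union>\<gamma>\<in>keys (sum_list (columns K)). {(\<alpha>, \<beta>). \<alpha> + \<beta> = \<gamma>}"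
  let ?d = "2 * mdeg (sum_list (columns K))"
  let ?V = "\<lambda>C. {I. mdeg (sum_list (columns I)) \<le> ?d \<and> keys (sum_list (columns I)) \<subseteq> C}"
  show "{(I, J). (delta_number K I J :: 'k) \<noteq> 0} \<subseteq> ?V (fst ` ?D) \<times> ?V (snd ` ?D)"
  proof
    fix p
    assume "p \<in> {(I, J). (delta_number K I J :: 'k) \<noteq> 0}"
    then obtain I J where p: "p = (I, J)" and K: "(delta_number K I J :: 'k) \<noteq> 0"
      by auto
    have "mdeg (sum_list (columns I)) \<le> ?d" "mdeg (sum_list (columns J)) \<le> ?d"
      using delta_number_nonzero(1)[OF K] by simp_all
    moreover have "keys (sum_list (columns I)) \<subseteq> fst ` ?D" "keys (sum_list (columns J)) \<subseteq> snd ` ?D"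
      using delta_number_nonzero(3,4)[OF K] by force+
    ultimately show "p \<in> ?V (fst ` ?D) \<times> ?V (snd ` ?D)"
      by (simp add: p)
  qed
  have "finite ?D"
    by (intro finite_UN_I finite_decomp) simp
  then show "finite (?V (fst ` ?D) \<times> ?V (snd ` ?D))"
    by (intro finite_cartesian_product finite_vcomps) simp_all
qed

section \<open>Coordinates in the family M_I(X) M_J(Y)\<close>

lemma mcoeff_mscale: "mcoeff (mscale c f) m = c * mcoeff f m"
  by (simp add: mscale_def)

lemma qsym_MM_eq_iff:
  "qsym_MM I J = (qsym_MM I' J' :: ('c xyvar, 'k::comm_ring_1) mps) \<longleftrightarrow> I = I' \<and> J = J'"
proof
  assume "qsym_MM I J = (qsym_MM I' J' :: ('c xyvar, 'k) mps)"
  then have "mcoeff (qsym_MM I J :: ('c xyvar, 'k) mps) (xy_mon (columns I) (columns J)) =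
      mcoeff (qsym_MM I' J') (xy_mon (columns I) (columns J))"
    by simp
  then show "I = I' \<and> J = J'"
    by (simp add: mcoeff_qsym_MM split: if_splits)
qed simp

lemma inj_qsym_MM: "inj (\<lambda>(I, J). qsym_MM I J :: ('c xyvar, 'k::comm_ring_1) mps)"
  by (rule injI) (auto simp: qsym_MM_eq_iff)

text \<open>The coefficient at the packed monomial of (I, J) is 1 on \<open>qsym_MM I J\<close> and
  0 on every other member; applied to a vanishing combination it isolates one coefficient.\<close>

lemma independent_qsym_MM:
  "mps.independent (range (\<lambda>(I, J). qsym_MM I J :: ('c xyvar, 'k::comm_ring_1) mps))"
  unfolding mps.dependent_explicit
proof (rule notI, elim exE conjE bexE)
  fix T :: "('c xyvar, 'k) mps set" and u f
  assume T: "finite T" "T \<subseteq> range (\<lambda>(I, J). qsym_MM I J)" "f \<in> T" "u f \<noteq> 0"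
    and sum: "(\<Sum>g\<in>T. mscale (u g) g) = 0"
  from T obtain I J where f: "f = qsym_MM I J"
    by auto
  let ?m = "xy_mon (columns I) (columns J)"
  have "mcoeff g ?m = (if g = f then 1 else 0)" if "g \<in> T" for g
  proof -
    from that T obtain I' J' where g: "g = qsym_MM I' J'"
      by auto
    show ?thesis
      by (auto simp: f g mcoeff_qsym_MM qsym_MM_eq_iff)
  qed
  then have "(\<Sum>g\<in>T. u g * mcoeff g ?m) = (\<Sum>g\<in>T. if g = f then u f else 0)"
    by (intro sum.cong) auto
  also have "\<dots> = u f"
    using T by simp
  finally show False
    using arg_cong[OF sum, of "\<lambda>g. mcoeff g ?m"] T by (simp add: mcoeff_sum mcoeff_mscale mcoeff_simps)
qed

text \<open>At \<open>xy_mon u v\<close> the left side depends only on \<open>compress u\<close> and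
  \<open>compress v\<close> by quasi-symmetry, and on the right only this pair survives.\<close>

lemma qsym_delta_expand:
  fixes K :: "'c::semigroup_add vcomp"
  assumes finite_decomp: "\<And>\<gamma> :: 'c. finite {(\<alpha>, \<beta>). \<alpha> + \<beta> = \<gamma>}"
  shows "(qsym_delta K :: ('c xyvar, 'k::comm_ring_1) mps) =
    (\<Sum>(I, J) | delta_number K I J \<noteq> (0 :: 'k). mscale (delta_number K I J) (qsym_MM I J))"
proof (rule mps_eqI)
  fix m :: "'c xyvar \<Rightarrow>\<^sub>0 nat"
  obtain u v where m: "m = xy_mon u v"
    using xy_mon_surj by blast
  let ?S = "{(I, J). delta_number K I J \<noteq> (0 :: 'k)}"
  have "mcoeff (\<Sum>(I, J)\<in>?S. mscale (delta_number K I J) (qsym_MM I J) :: ('c xyvar, 'k) mps) m =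
      (\<Sum>p\<in>?S. if p = (compress u, compress v) then delta_number K (compress u) (compress v) else 0)"
    unfolding mcoeff_sum m
    by (intro sum.cong) (auto simp: mcoeff_mscale mcoeff_qsym_MM split: if_splits)
  also have "\<dots> = delta_number K (compress u) (compress v)"
    using finite_delta_number_right[OF finite_decomp, of K, where ?'k = 'k] by (simp add: sum.delta)
  finally show "mcoeff (qsym_delta K :: ('c xyvar, 'k) mps) m =
      mcoeff (\<Sum>(I, J)\<in>?S. mscale (delta_number K I J) (qsym_MM I J)) m"
    by (simp add: m qsym_delta_xy_mon)
qed

lemma delta_coeff_eq:
  fixes K :: "'c::semigroup_add vcomp"
  assumes finite_decomp: "\<And>\<gamma> :: 'c. finite {(\<alpha>, \<beta>). \<alpha> + \<beta> = \<gamma>}"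
  shows "(delta_coeff K I J :: 'k::comm_ring_1) = delta_number K I J"
proof -
  define M where "M = (\<lambda>(I, J). qsym_MM I J :: ('c xyvar, 'k) mps)"
  have inj: "inj M"
    unfolding M_def by (rule inj_qsym_MM)
  define d where "d = (\<lambda>(I, J). delta_number K I J :: 'k)"
  \<comment> \<open>\<open>mps.representation\<close> indexes coefficients by the basis series
    themselves, so \<open>d\<close> is transported along the injection \<open>M\<close>, with value
    0 off its range.\<close>
  define f where "f = (\<lambda>g. if g \<in> range M then d (inv M g) else 0)"
  have f_M: "f (M p) = d p" for p
    using inv_f_f[OF inj, of p] by (simp add: f_def)
  have f_nonzero: "{g. f g \<noteq> 0} = M ` {p. d p \<noteq> 0}"
  proof (intro subset_antisym subsetI)
    fix g
    assume "g \<in> {g. f g \<noteq> 0}"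
    then have g: "f g \<noteq> 0" "g \<in> range M"
      by (auto simp: f_def split: if_splits)
    then obtain p where "g = M p"
      by blast
    with g f_M show "g \<in> M ` {p. d p \<noteq> 0}"
      by auto
  qed (use f_M in auto)
  have fin: "finite {p. d p \<noteq> 0}"
    using finite_delta_number_right[OF finite_decomp, of K, where ?'k = 'k]
    by (simp add: d_def case_prod_unfold)
  have expand: "qsym_delta K = (\<Sum>p | d p \<noteq> 0. mscale (d p) (M p))"
    using qsym_delta_expand[OF finite_decomp, of K, where ?'k = 'k] by (simp add: d_def M_def case_prod_unfold)
  have "mps.representation (range M) (qsym_delta K) = f"
  proof (rule mps.representation_eqI)
    show "mps.independent (range M)"
      unfolding M_def by (rule independent_qsym_MM)
    show "qsym_delta K \<in> mps.span (range M)"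
      unfolding expand by (intro mps.span_sum mps.span_scale mps.span_base rangeI)
    show "g \<in> range M" if "f g \<noteq> 0" for g
      using that by (auto simp: f_def split: if_splits)
    show "finite {g. f g \<noteq> 0}"
      unfolding f_nonzero using fin by simp
    have "(\<Sum>g | f g \<noteq> 0. mscale (f g) g) = (\<Sum>p | d p \<noteq> 0. mscale (f (M p)) (M p))"
      unfolding f_nonzero by (rule sum.reindex_cong[OF inj_on_subset[OF inj]]) auto
    then show "(\<Sum>g | f g \<noteq> 0. mscale (f g) g) = qsym_delta K"
      by (simp only: f_M expand)
  qed
  then have "mps.representation (range M) (qsym_delta K) (M (I, J)) = d (I, J)"
    by (simp add: f_M)
  then show ?thesis
    by (simp add: delta_coeff_def d_def M_def)
qed

lemma lookup_internal_basis:
  fixes I J K :: "'c::semigroup_add vcomp"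
  assumes finite_decomp: "\<And>\<gamma> :: 'c. finite {(\<alpha>, \<beta>). \<alpha> + \<beta> = \<gamma>}"
  shows "lookup (internal_basis I J :: ('c, 'k::comm_ring_1) sym) K = delta_number K I J"
  using finite_delta_number_left[of I J, where ?'k = 'k]
  by (simp add: internal_basis_def delta_coeff_eq[OF finite_decomp])

section \<open>Splitting by rows\<close>

definition take_vcomp :: "nat \<Rightarrow> 'c vcomp \<Rightarrow> 'c vcomp" where
  "take_vcomp t K = Vcomp (take t (columns K))"

definition drop_vcomp :: "nat \<Rightarrow> 'c vcomp \<Rightarrow> 'c vcomp" where
  "drop_vcomp t K = Vcomp (drop t (columns K))"

lemma columns_take_vcomp: "columns (take_vcomp t K) = take t (columns K)"
  using zero_notin_columns[of K] by (auto simp: take_vcomp_def intro!: Vcomp_inverse dest: in_set_takeD)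

lemma columns_drop_vcomp: "columns (drop_vcomp t K) = drop t (columns K)"
  using zero_notin_columns[of K] by (auto simp: drop_vcomp_def intro!: Vcomp_inverse dest: in_set_dropD)

lemma columns_plus: "columns (I + J) = columns I @ columns J"
  unfolding plus_vcomp_def by (rule Vcomp_inverse) simp

lemma columns_zero: "columns 0 = []"
  unfolding zero_vcomp_def by (rule Vcomp_inverse) simp

text \<open>In a free monoid a factorization of a word is determined by the position of the
  cut.\<close>

lemma vcomp_decompositions:
  "{(A, B). A + B = K} = (\<lambda>t. (take_vcomp t K, drop_vcomp t K)) ` {..length (columns K)}"
proof (intro subset_antisym subsetI)
  fix p
  assume "p \<in> {(A, B). A + B = K}"
  then obtain A B where p: "p = (A, B)" and K: "K = A + B"
    by auto
  then have "p = (take_vcomp (length (columns A)) K, drop_vcomp (length (columns A)) K)"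
    by (simp add: columns_inject[symmetric] columns_take_vcomp columns_drop_vcomp columns_plus)
  moreover have "length (columns A) \<le> length (columns K)"
    by (simp add: K columns_plus)
  ultimately show "p \<in> (\<lambda>t. (take_vcomp t K, drop_vcomp t K)) ` {..length (columns K)}"
    by blast
next
  fix p
  assume "p \<in> (\<lambda>t. (take_vcomp t K, drop_vcomp t K)) ` {..length (columns K)}"
  then show "p \<in> {(A, B). A + B = K}"
    by (auto simp: columns_inject[symmetric] columns_take_vcomp columns_drop_vcomp columns_plus)
qed

text \<open>Uses the same cuts \<open>t\<close> as \<open>list_M_append\<close>, so that the product
  of Sym and the ordinal sum of alphabets can be matched term by term.\<close>

lemma lookup_sym_mult:
  fixes F G :: "('c, 'k::comm_ring_1) sym"
  shows "lookup (F * G) K =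
    (\<Sum>t\<le>length (columns K). lookup F (take_vcomp t K) * lookup G (drop_vcomp t K))"
proof -
  let ?D = "{(A, B). A + B = K}"
  have inj: "inj_on (\<lambda>t. (take_vcomp t K, drop_vcomp t K)) {..length (columns K)}"
  proof (rule inj_onI)
    fix s t
    assume "s \<in> {..length (columns K)}" "t \<in> {..length (columns K)}"
      and eq: "(take_vcomp s K, drop_vcomp s K) = (take_vcomp t K, drop_vcomp t K)"
    moreover from eq have "length (take s (columns K)) = length (take t (columns K))"
      by (metis columns_take_vcomp fst_conv)
    ultimately show "s = t"
      by simp
  qed
  have "lookup (F * G) K = prod_fun (lookup F) (lookup G) K"
    by (simp add: times_poly_mapping.rep_eq)
  also have "\<dots> = (\<Sum>(A, B). lookup F A * lookup G B when K = A + B)"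
    by (rule prod_fun_unfold_prod) simp_all
  also have "\<dots> = (\<Sum>p\<in>?D. case p of (A, B) \<Rightarrow> lookup F A * lookup G B when K = A + B)"
  proof (rule Sum_any.expand_superset)
    show "finite ?D"
      by (simp add: vcomp_decompositions)
  qed auto
  also have "\<dots> = (\<Sum>p\<in>?D. lookup F (fst p) * lookup G (snd p))"
    by (intro sum.cong) auto
  also have "\<dots> = (\<Sum>t\<le>length (columns K). lookup F (take_vcomp t K) * lookup G (drop_vcomp t K))"
    unfolding vcomp_decompositions by (simp add: sum.reindex[OF inj])
  finally show ?thesis .
qed

text \<open>One pair per column, zero parts included. Lists of pairs are used because different
  splittings may give the same two compositions after compression, and the coproduct counts them
  with multiplicity.\<close>

definition splittings :: "('c \<Rightarrow>\<^sub>0 nat) list \<Rightarrow> (('c \<Rightarrow>\<^sub>0 nat) \<times> ('c \<Rightarrow>\<^sub>0 nat)) list set" where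
  "splittings ns = {ps. map (\<lambda>(i, j). i + j) ps = ns}"

lemma splittings_Nil: "splittings [] = {[]}"
  by (auto simp: splittings_def)

lemma splittings_Cons:
  "splittings (n # ns) = (\<lambda>(p, ps). p # ps) ` ({(i, j). i + j = n} \<times> splittings ns)"
  by (auto simp: splittings_def Cons_eq_map_conv map_eq_Cons_conv image_iff)

lemma compress_Cons: "compress (n # u) = one_column n + compress u"
  by (simp add: columns_inject[symmetric] columns_plus columns_compress one_column_def Vcomp_inverse)

text \<open>Expanding the product chooses one term per column; zero parts disappear because
  \<open>one_column 0\<close> is the empty composition.\<close>

lemma prod_list_coproduct_gen:
  "(prod_list (map coproduct_gen ns) :: ('c, 'k::comm_ring_1) sym2) =
    (\<Sum>ps\<in>splittings ns. single (compress (map fst ps), compress (map snd ps)) 1)"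
proof (induction ns)
  case Nil
  have "compress [] = (0 :: 'c vcomp)"
    by (simp add: columns_inject[symmetric] columns_compress columns_zero)
  moreover have "(single (0, 0) 1 :: ('c, 'k) sym2) = 1"
    by (metis single_one zero_prod_def)
  ultimately show ?case
    by (simp add: splittings_Nil)
next
  case (Cons n ns)
  let ?s = "\<lambda>ps. single (compress (map fst ps), compress (map snd ps)) 1 :: ('c, 'k) sym2"
  have "prod_list (map coproduct_gen (n # ns)) =
      (\<Sum>p\<in>{(i, j). i + j = n}. \<Sum>ps\<in>splittings ns. ?s (p # ps))"
    by (simp add: Cons.IH coproduct_gen_def sum_product case_prod_unfold mult_single compress_Cons)
  also have "\<dots> = (\<Sum>(p, ps)\<in>{(i, j). i + j = n} \<times> splittings ns. ?s (p # ps))"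
    by (rule sum.cartesian_product)
  also have "\<dots> = (\<Sum>ps\<in>splittings (n # ns). ?s ps)"
    unfolding splittings_Cons by (subst sum.reindex) (auto simp: inj_on_def case_prod_unfold)
  finally show ?case .
qed

lemma coproduct_Sbasis:
  "(coproduct (Sbasis J) :: ('c, 'k::comm_ring_1) sym2) =
    (\<Sum>ps\<in>splittings (columns J). single (compress (map fst ps), compress (map snd ps)) 1)"
  by (simp add: coproduct_def Sbasis_def lin_ext_single fscale_one prod_list_coproduct_gen)

section \<open>Distributing a monomial over two blocks of rows\<close>

lemma rows_xy_mon: "rows (xy_mon u v) \<subseteq> {..<length u}"
  and cols_xy_mon: "cols (xy_mon u v) \<subseteq> {..<length v}"
  by (auto simp: rows_def cols_def in_keys_iff split: if_splits)

text \<open>Once the rows are assigned to blocks, the x exponents are forced, while each column may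
  be split arbitrarily. The second part keeps its row numbers, hence the \<open>length u\<close>
  zero rows in front of \<open>u'\<close>.\<close>

lemma xy_mon_factorizations:
  "{(a, b). a + b = xy_mon (u @ u') v \<and> rows a \<subseteq> {..<length u} \<and> rows b \<inter> {..<length u} = {}} =
    (\<lambda>ps. (xy_mon u (map fst ps), xy_mon (replicate (length u) 0 @ u') (map snd ps))) ` splittings v"
    (is "?L = ?f ` _")
proof (intro subset_antisym subsetI)
  fix p
  assume "p \<in> ?L"
  then obtain a b where p: "p = (a, b)" and ab: "a + b = xy_mon (u @ u') v"
    and a: "rows a \<subseteq> {..<length u}" and b: "rows b \<inter> {..<length u} = {}"
    by auto
  let ?ps = "map (\<lambda>s. (Poly_Mapping.map_key (\<lambda>c. Inr (s, c)) a, Poly_Mapping.map_key (\<lambda>c. Inr (s, c)) b))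
    [0..<length v]"
  have sum: "lookup a x + lookup b x = lookup (xy_mon (u @ u') v) x" for x
    unfolding ab[symmetric] lookup_add ..
  have key: "lookup (Poly_Mapping.map_key (\<lambda>c. Inr (s, c)) m) c = lookup m (Inr (s, c))" for s c and m :: "'a xyvar \<Rightarrow>\<^sub>0 nat"
    by (simp add: map_key.rep_eq inj_def)
  have a0: "lookup a (Inl (r, c)) = 0" if "r \<ge> length u" for r c
    using a that by (auto simp: rows_def in_keys_iff)
  have b0: "lookup b (Inl (r, c)) = 0" if "r < length u" for r c
    using b that by (auto simp: rows_def in_keys_iff)
  have "?ps \<in> splittings v"
    unfolding splittings_def mem_Collect_eq
  proof (rule nth_equalityI)
    fix s
    assume "s < length (map (\<lambda>(i, j). i + j) ?ps)"
    then have s: "s < length v"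
      by simp
    show "map (\<lambda>(i, j). i + j) ?ps ! s = v ! s"
    proof (rule poly_mapping_eqI)
      fix c
      show "lookup (map (\<lambda>(i, j). i + j) ?ps ! s) c = lookup (v ! s) c"
        using sum[of "Inr (s, c)"] s by (simp add: lookup_add key)
    qed
  qed simp
  moreover have "a = xy_mon u (map fst ?ps)"
  proof (rule poly_mapping_eqI)
    fix x
    show "lookup a x = lookup (xy_mon u (map fst ?ps)) x"
    proof (cases x rule: xyvar_cases)
      case (1 r c)
      then show ?thesis
        using sum[of x] a0[of r c] b0[of r c] by (cases "r < length u") (simp_all add: nth_append)
    next
      case (2 s c)
      then show ?thesis
        using sum[of x] by (cases "s < length v") (simp_all add: key)
    qed
  qed
  moreover have "b = xy_mon (replicate (length u) 0 @ u') (map snd ?ps)"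
  proof (rule poly_mapping_eqI)
    fix x
    show "lookup b x = lookup (xy_mon (replicate (length u) 0 @ u') (map snd ?ps)) x"
    proof (cases x rule: xyvar_cases)
      case (1 r c)
      then show ?thesis
        using sum[of x] a0[of r c] b0[of r c] by (cases "r < length u") (simp_all add: nth_append)
    next
      case (2 s c)
      then show ?thesis
        using sum[of x] by (cases "s < length v") (simp_all add: key)
    qed
  qed
  ultimately have "p = ?f ?ps" "?ps \<in> splittings v"
    unfolding p by blast+
  then show "p \<in> ?f ` splittings v"
    by (rule image_eqI)
next
  fix p
  assume "p \<in> ?f ` splittings v"
  then obtain ps where p: "p = ?f ps" and ps: "map (\<lambda>(i, j). i + j) ps = v"
    by (auto simp: splittings_def)
  have len: "length v = length ps"
    using ps by auto
  have nth: "lookup (v ! s) c = lookup (fst (ps ! s)) c + lookup (snd (ps ! s)) c" if "s < length ps" for s c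
    using that by (simp add: ps[symmetric] case_prod_unfold lookup_add)
  have "fst p + snd p = xy_mon (u @ u') v"
  proof (rule poly_mapping_eqI)
    fix x
    show "lookup (fst p + snd p) x = lookup (xy_mon (u @ u') v) x"
      by (cases x rule: xyvar_cases) (auto simp: p lookup_add nth_append len nth)
  qed
  moreover have "rows (fst p) \<subseteq> {..<length u}"
    using rows_xy_mon by (simp add: p)
  moreover have "rows (snd p) \<inter> {..<length u} = {}"
    by (auto simp: p rows_def in_keys_iff nth_append split: if_splits)
  ultimately show "p \<in> ?L"
    by (simp add: case_prod_unfold)
qed

text \<open>\<open>xy_mon\<close> forgets trailing zero vectors, but all splittings of
  \<open>v\<close> have the length of \<open>v\<close>, so the pairs can be recovered from the y
  exponents.\<close>

lemma inj_on_splittings: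
  "inj_on (\<lambda>ps. (xy_mon u (map fst ps), xy_mon u' (map snd ps))) (splittings v)"
proof (rule inj_onI)
  fix ps qs
  assume ps: "ps \<in> splittings v" and qs: "qs \<in> splittings v"
    and eq: "(xy_mon u (map fst ps), xy_mon u' (map snd ps)) = (xy_mon u (map fst qs), xy_mon u' (map snd qs))"
  from ps qs have len: "length ps = length qs"
    unfolding splittings_def mem_Collect_eq by (metis length_map)
  show "ps = qs"
  proof (rule nth_equalityI[OF len])
    fix s
    assume s: "s < length ps"
    have "lookup (fst (ps ! s)) c = lookup (fst (qs ! s)) c" "lookup (snd (ps ! s)) c = lookup (snd (qs ! s)) c" for c
      using arg_cong[OF eq, of "\<lambda>p. lookup (fst p) (Inr (s, c))"]
        arg_cong[OF eq, of "\<lambda>p. lookup (snd p) (Inr (s, c))"] s len by simp_all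
    then show "ps ! s = qs ! s"
      by (auto intro!: prod_eqI poly_mapping_eqI)
  qed
qed

lemma delta_number_mult:
  fixes I I' J K :: "'c::semigroup_add vcomp"
  shows "(delta_number K (I + I') J :: 'k::comm_ring_1) =
    (\<Sum>t\<le>length (columns K). \<Sum>ps\<in>splittings (columns J).
      delta_number (take_vcomp t K) I (compress (map fst ps)) *
      delta_number (drop_vcomp t K) I' (compress (map snd ps)))"
proof -
  define u u' v where "u = columns I" and "u' = columns I'" and "v = columns J"
  let ?f = "alphabet_power alph_XY :: nat \<times> nat \<Rightarrow> ('c \<Rightarrow>\<^sub>0 nat) \<Rightarrow> ('c xyvar, 'k) mps"
  let ?A = "{..<length u} \<times> {..<length v}" and ?B = "{length u..<length u + length u'} \<times> {..<length v}"
  let ?xs = "sorted_list_of_set ?A" and ?ys = "sorted_list_of_set ?B"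
  let ?m = "xy_mon (u @ u') v" and ?w = "replicate (length u) 0 @ u'"
  \<comment> \<open>The row is compared first, so every pair of the first block precedes every pair
    of the second.\<close>
  have sorted: "sorted_wrt (<) (?xs @ ?ys)"
    unfolding sorted_wrt_append by (auto simp: less_prod_def)
  have set: "set (?xs @ ?ys) = {..<length u + length u'} \<times> {..<length v}"
    by auto
  have "rows ?m \<times> cols ?m \<subseteq> set (?xs @ ?ys)"
    unfolding set using rows_xy_mon[of "u @ u'" v] cols_xy_mon[of "u @ u'" v] by auto
  from mcoeff_qsym_delta[OF sorted this, of K, where ?'k = 'k]
  have "(delta_number K (I + I') J :: 'k) = mcoeff (list_M ?f (?xs @ ?ys) (columns K)) ?m"
    by (simp add: delta_number_def columns_plus u_def u'_def v_def)
  also have "\<dots> = (\<Sum>t\<le>length (columns K).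
      mcoeff (list_M ?f ?xs (columns (take_vcomp t K)) * list_M ?f ?ys (columns (drop_vcomp t K))) ?m)"
    by (simp add: list_M_append mcoeff_sum columns_take_vcomp columns_drop_vcomp)
  also have "\<dots> = (\<Sum>t\<le>length (columns K). \<Sum>ps\<in>splittings v.
      delta_number (take_vcomp t K) I (compress (map fst ps)) *
      delta_number (drop_vcomp t K) I' (compress (map snd ps)))"
  proof (intro sum.cong refl)
    fix t
    let ?K = "take_vcomp t K" and ?K' = "drop_vcomp t K"
    let ?F = "list_M ?f ?xs (columns ?K)" and ?G = "list_M ?f ?ys (columns ?K')"
    have rows_F: "rows a \<subseteq> {..<length u}" if "mcoeff ?F a \<noteq> 0" for a
      using xy_content_list_M[OF that zero_notin_columns] by (fastforce simp: xy_content_def)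
    have rows_G: "rows b \<inter> {..<length u} = {}" if "mcoeff ?G b \<noteq> 0" for b
      using xy_content_list_M[OF that zero_notin_columns] by (fastforce simp: xy_content_def)
    have F: "mcoeff ?F (xy_mon u (map fst ps)) = delta_number ?K I (compress (map fst ps))"
      if "ps \<in> splittings v" for ps
    proof -
      have "length ps = length v"
        using that by (auto simp: splittings_def)
      then have "rows (xy_mon u (map fst ps)) \<times> cols (xy_mon u (map fst ps)) \<subseteq> set ?xs"
        using rows_xy_mon[of u "map fst ps"] cols_xy_mon[of u "map fst ps"] by auto
      from mcoeff_qsym_delta[OF _ this, of ?K, where ?'k = 'k] show ?thesis
        by (simp add: qsym_delta_xy_mon u_def)
    qed
    have G: "mcoeff ?G (xy_mon ?w (map snd ps)) = delta_number ?K' I' (compress (map snd ps))"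
      if "ps \<in> splittings v" for ps
    proof -
      have "length ps = length v"
        using that by (auto simp: splittings_def)
      moreover have "rows (xy_mon ?w (map snd ps)) \<subseteq> {length u..<length u + length u'}"
        by (auto simp: rows_def in_keys_iff nth_append split: if_splits)
      ultimately have "rows (xy_mon ?w (map snd ps)) \<times> cols (xy_mon ?w (map snd ps)) \<subseteq> set ?ys"
        using cols_xy_mon[of ?w "map snd ps"] by auto
      \<comment> \<open>The zero rows in front of \<open>u'\<close> vanish under compression, so the
        second factor is evaluated at \<open>I'\<close> itself.\<close>
      moreover have "compress ?w = I'"
        using columns_compress[of "columns I'"] by (simp add: compress_eq_iff u'_def)
      ultimately show ?thesis
        using mcoeff_qsym_delta[of ?ys "xy_mon ?w (map snd ps)" ?K', where ?'k = 'k]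
        by (simp add: qsym_delta_xy_mon)
    qed
    \<comment> \<open>The blocks have disjoint row sets, so decompositions that mix their rows
      contribute nothing.\<close>
    have "mcoeff (?F * ?G) ?m = (\<Sum>(a, b)\<in>{(a, b). a + b = ?m \<and> rows a \<subseteq> {..<length u} \<and>
        rows b \<inter> {..<length u} = {}}. mcoeff ?F a * mcoeff ?G b)"
      unfolding mcoeff_simps
    proof (rule sum.mono_neutral_right[OF finite_decompositions], blast, intro ballI)
      fix p
      assume "p \<in> {(a, b). a + b = ?m} - {(a, b). a + b = ?m \<and> rows a \<subseteq> {..<length u} \<and>
        rows b \<inter> {..<length u} = {}}"
      then obtain a b where p: "p = (a, b)" and "\<not> (rows a \<subseteq> {..<length u} \<and> rows b \<inter> {..<length u} = {})"
        by auto
      then have "mcoeff ?F a = 0 \<or> mcoeff ?G b = 0"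
        using rows_F rows_G by blast
      then show "(case p of (a, b) \<Rightarrow> mcoeff ?F a * mcoeff ?G b) = 0"
        by (auto simp: p)
    qed
    also have "\<dots> = (\<Sum>ps\<in>splittings v. mcoeff ?F (xy_mon u (map fst ps)) * mcoeff ?G (xy_mon ?w (map snd ps)))"
      unfolding xy_mon_factorizations by (simp add: sum.reindex[OF inj_on_splittings])
    also have "\<dots> = (\<Sum>ps\<in>splittings v. delta_number ?K I (compress (map fst ps)) *
        delta_number ?K' I' (compress (map snd ps)))"
      by (intro sum.cong) (simp_all add: F G)
    finally show "mcoeff (?F * ?G) ?m = \<dots>" .
  qed
  finally show ?thesis
    by (simp add: v_def)
qed

text \<open>After both sides are expanded, the sum over cuts of \<open>K\<close> and the sum over
  splittings of \<open>J\<close> only have to be interchanged.\<close>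

lemma internal_basis_mult:
  fixes I I' J :: "'c::semigroup_add vcomp"
  assumes finite_decomp: "\<And>\<gamma> :: 'c. finite {(\<alpha>, \<beta>). \<alpha> + \<beta> = \<gamma>}"
  shows "(internal_basis (I + I') J :: ('c, 'k::comm_ring_1) sym) =
    lin_ext (\<lambda>(J', J''). internal_basis I J' * internal_basis I' J'') (coproduct (Sbasis J))"
proof (rule poly_mapping_eqI)
  fix K
  let ?R = "lin_ext (\<lambda>(J', J''). internal_basis I J' * internal_basis I' J'' :: ('c, 'k) sym) (coproduct (Sbasis J))"
  have "?R = (\<Sum>ps\<in>splittings (columns J).
      internal_basis I (compress (map fst ps)) * internal_basis I' (compress (map snd ps)))"
    by (simp add: coproduct_Sbasis flinear_sum[OF flinear_lin_ext] lin_ext_single fscale_one)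
  then have "lookup ?R K = (\<Sum>ps\<in>splittings (columns J). \<Sum>t\<le>length (columns K).
      delta_number (take_vcomp t K) I (compress (map fst ps)) *
      delta_number (drop_vcomp t K) I' (compress (map snd ps)))"
    by (simp add: lookup_sum lookup_sym_mult lookup_internal_basis[OF finite_decomp])
  also have "\<dots> = delta_number K (I + I') J"
    unfolding delta_number_mult by (rule sum.swap)
  finally show "lookup (internal_basis (I + I') J :: ('c, 'k) sym) K = lookup ?R K"
    by (simp add: lookup_internal_basis[OF finite_decomp])
qed

text \<open>With no rows the alphabet of pairs is empty, so M_K reduces to the constant 1 or 0, and
  its coefficient is taken at a monomial in y alone.\<close>

lemma delta_number_zero:
  "(delta_number K 0 J :: 'k::comm_ring_1) = (if K = 0 \<and> J = 0 then 1 else 0)"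
proof -
  let ?m = "xy_mon [] (columns J)"
  have "rows ?m \<times> cols ?m \<subseteq> set []"
    using rows_xy_mon[of "[]" "columns J"] by simp
  from mcoeff_qsym_delta[OF _ this, of K, where ?'k = 'k]
  have "(delta_number K 0 J :: 'k) = (if columns K = [] \<and> ?m = 0 then 1 else 0)"
    by (simp add: delta_number_def columns_zero mcoeff_simps)
  moreover have "?m = 0 \<longleftrightarrow> columns J = []"
  proof -
    have "?m = 0 \<longleftrightarrow> row_mon (columns J) = 0"
      by (simp add: xy_mon_def row_mon_eq_0_iff[of "[]", simplified] push_0 push_eq_0_iff)
    also have "\<dots> \<longleftrightarrow> columns J = []"
      unfolding row_mon_eq_0_iff using zero_notin_columns[of J] by (cases "columns J") auto
    finally show ?thesis .
  qed
  moreover have "columns L = [] \<longleftrightarrow> L = 0" for L :: "'a vcomp"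
    by (metis columns_inject columns_zero)
  ultimately show ?thesis
    by simp
qed

text \<open>\<open>1\<close> is the basis element of the empty composition, so
  \<open>delta_number_zero\<close> leaves only the coefficient at 0. This is the counit, as the case
  r = 0 requires.\<close>

lemma internal_prod_one:
  fixes G :: "('c::semigroup_add, 'k::comm_ring_1) sym"
  assumes finite_decomp: "\<And>\<gamma> :: 'c. finite {(\<alpha>, \<beta>). \<alpha> + \<beta> = \<gamma>}"
  shows "internal_prod 1 G = single 0 (lookup G 0)"
proof (rule flinear_eqI[where F = G])
  show "flinear (internal_prod (1 :: ('c, 'k) sym))"
    unfolding internal_prod_def by (rule flinear_bilin_ext_right)
  show "flinear (\<lambda>G. single 0 (lookup G 0) :: ('c, 'k) sym)"
    by (simp add: flinear_def lookup_add single_add lookup_fscale fscale_single)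
  fix J :: "'c vcomp"
  have "internal_basis 0 J = (single 0 (lookup (single J 1) 0) :: ('c, 'k) sym)"
    by (rule poly_mapping_eqI)
       (simp add: lookup_internal_basis[OF finite_decomp] delta_number_zero lookup_single when_def)
  then show "internal_prod 1 (single J 1) = (single 0 (lookup (single J 1) 0) :: ('c, 'k) sym)"
    by (simp add: internal_prod_def bilin_ext_single flip: single_one)
qed

theorem proposition5p6:
  fixes Fs :: "('c::semigroup_add, 'k::comm_ring_1) sym list"
    and G :: "('c, 'k) sym"
  assumes finite_decomp: "\<And>\<gamma> :: 'c. finite {(\<alpha>, \<beta>). \<alpha> + \<beta> = \<gamma>}"
  shows "internal_prod (prod_list Fs) G =
    tensor_mult (tensor_internal_prod (pure_tensor Fs) (iterated_coproduct (length Fs) G))"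
  by (intro internal_prod_prod_list internal_prod_one internal_prod_mult internal_basis_mult finite_decomp)

end
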